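(* Consider the three-stage DPG method $$u_{n+1}=e^{hJ_n}u_n+hb_1(hJ_n)g_n(u_n)+hb_2(hJ_n)\bigl(g_n(u_{n_2})+C_{n_2}\bigr)+hb_3(hJ_n)g_n(u_{n_3}),$$ $$u_{n_2}=u_n+h\varphi_2(hJ_n)\bigl(g_n(u_n)+J_nu_n\bigr),\qquad u_{n_3}=u_n+hJ_nu_{n_2}+hg_n(u_n),$$ with correction factor $C_{n_2}:=-\frac14\,g_n'(u_{n_2})(u_{n_3}-2u_{n_2}+u_n)$ and coefficient functions satisfying $$b_1(hJ_n)+b_2(hJ_n)+b_3(hJ_n)=\varphi_1(hJ_n),$$ $$\tfrac14 b_2(hJ_n)+b_3(hJ_n)=2\varphi_3(hJ_n),\qquad \tfrac18 b_2(hJ_n)+b_3(hJ_n)=6\varphi_4(hJ_n).$$ Then the method is fourth order, in the sense that its local truncation error $\hat e_{n+1}=\bar u_{n+1}-u(t_{n+1})$ satisfies $$\hat e_{n+1}=\mathcal O(h^5).$$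
   Context: Let $X$ be a Banach space with norm $\|\cdot\|$, $T>0$, and consider $u'(t)=F(u(t))$, $u(0)=u_0$ on $[0,T]$. Assumption 1: $u\in C([0,T);X)\cap C^1((0,T);X)$, and $F:X\to X$ is sufficiently many times Fréchet differentiable in a strip along the exact solution $u$ with all derivatives uniformly bounded; hence the Jacobian $J(v)=\frac{\partial F}{\partial u}(v)$ satisfies $\|J(v)-J(w)\|_{\mathcal L(X)}\le C\|v-w\|$ in a neighborhood of the exact solution. Assumption 2: the linear operator $J=J(v)$ generates a strongly continuous semigroup on $X$, with constants $C,\omega$ such that $\|e^{tJ}\|_{\mathcal L(X)}\le Ce^{\omega t}$, $t\ge0$, uniformly in a neighborhood of the exact solution (i.e. for all $v$ there). Uniform grid: $0=t_0<\dots<t_N=T$, $h=t_{n+1}-t_n$; $u(T)$ is understood by continuity. $u_n\approx u(t_n)$ denotes the numerical solution, $J_n=\frac{\partial F}{\partial u}(u_n)$, $g_n(v)=F(v)-J_nv$, and $g_n'$ is the Fréchet derivative of $g_n$, i.e. $g_n'(v)=J(v)-J_n$. The $\varphi$-functions are $\varphi_0(z)=e^z$ and $\varphi_p(z)=\int_0^1e^{(1-\theta)z}\frac{\theta^{p-1}}{(p-1)!}\,d\theta$ for $p\ge1$; applied to $hJ$ via the semigroup $e^{tJ}$. Local truncation error: put $\hat u_n=u(t_n)$, $\hat J_n=\frac{\partial F}{\partial u}(\hat u_n)$, $\hat g_n(v)=F(v)-\hat J_nv$. Then $\bar u_{n+1}$ (with internal stages $\bar u_{n_2},\bar u_{n_3}$)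 is the result of one step of the method started from $\hat u_n$, i.e. with $u_n,J_n,g_n$ replaced everywhere (including in the correction factor) by $\hat u_n,\hat J_n,\hat g_n$. $\mathcal O(h^k)$ means bounded in norm by $Ch^k$ as $h\to0$ with $C$ independent of $n$ and $h$. *)

theory Defs
  imports "HOL-Analysis.Analysis"
begin

text \<open>
  Everywhere below the Jacobian \<open>J v\<close> of \<open>F :: 'a \<Rightarrow> 'a\<close> is a bounded operator (it is a Frechet
  derivative on the Banach space), represented in \<open>'a \<Rightarrow>\<^sub>L 'a\<close>.
\<close>

definition strip :: "(real \<Rightarrow> 'a::banach) \<Rightarrow> real \<Rightarrow> real \<Rightarrow> 'a set" where
  "strip u T r = (\<Union>t\<in>{0..T}. ball (u t) r)"

definition C0_semigroup :: "(real \<Rightarrow> 'a::banach \<Rightarrow>\<^sub>L 'a) \<Rightarrow> bool" where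
  "C0_semigroup E \<longleftrightarrow>
     E 0 = id_blinfun \<and>
     (\<forall>s\<ge>0. \<forall>t\<ge>0. E (s + t) = E s o\<^sub>L E t) \<and>
     (\<forall>x. ((\<lambda>t. blinfun_apply (E t) x) \<longlongrightarrow> x) (at_right 0))"

text \<open>
  For a bounded \<open>A\<close> the domain of the infinitesimal generator is the whole space, so the defining
  limit is required at every point. Only the values \<open>E t\<close> for \<open>t \<ge> 0\<close> matter.
\<close>

definition generates :: "('a::banach \<Rightarrow>\<^sub>L 'a) \<Rightarrow> (real \<Rightarrow> 'a \<Rightarrow>\<^sub>L 'a) \<Rightarrow> bool" where
  "generates A E \<longleftrightarrow> C0_semigroup E \<and>
     (\<forall>x. ((\<lambda>t. (blinfun_apply (E t) x - x) /\<^sub>R t) \<longlongrightarrow> blinfun_apply A x) (at_right 0))"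

text \<open>
  If \<open>E t\<close> is \<open>exp (t A)\<close>, then \<open>phi p E h\<close> is the operator \<open>\<phi>\<^sub>p(h A)\<close>. The integral is taken
  pointwise because a strongly continuous semigroup need not be continuous in operator norm.
\<close>

definition phi :: "nat \<Rightarrow> (real \<Rightarrow> 'a::banach \<Rightarrow>\<^sub>L 'a) \<Rightarrow> real \<Rightarrow> 'a \<Rightarrow>\<^sub>L 'a" where
  "phi p E h =
     (if p = 0 then E h
      else Blinfun (\<lambda>x. integral {0..1}
             (\<lambda>\<theta>. (\<theta> ^ (p - 1) / fact (p - 1)) *\<^sub>R blinfun_apply (E ((1 - \<theta>) * h)) x)))"

text \<open>
  In the following, \<open>w\<close> is the point \<open>u\<^sub>n\<close> from which the step starts, so that \<open>J\<^sub>n = J w\<close>;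
  \<open>S w\<close> is the semigroup generated by \<open>J w\<close>. \<open>nonlin_deriv\<close> is the Frechet derivative of
  \<open>nonlin F J w\<close>.
\<close>

definition nonlin :: "('a::banach \<Rightarrow> 'a) \<Rightarrow> ('a \<Rightarrow> 'a \<Rightarrow>\<^sub>L 'a) \<Rightarrow> 'a \<Rightarrow> 'a \<Rightarrow> 'a" where
  "nonlin F J w v = F v - blinfun_apply (J w) v"

definition nonlin_deriv :: "('a::banach \<Rightarrow> 'a \<Rightarrow>\<^sub>L 'a) \<Rightarrow> 'a \<Rightarrow> 'a \<Rightarrow> 'a \<Rightarrow>\<^sub>L 'a" where
  "nonlin_deriv J w v = J v - J w"

definition stage2 ::
  "('a::banach \<Rightarrow> 'a) \<Rightarrow> ('a \<Rightarrow> 'a \<Rightarrow>\<^sub>L 'a) \<Rightarrow> ('a \<Rightarrow> real \<Rightarrow> 'a \<Rightarrow>\<^sub>L 'a) \<Rightarrow> real \<Rightarrow> 'a \<Rightarrow> 'a" where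
  "stage2 F J S h w =
     w + h *\<^sub>R blinfun_apply (phi 2 (S w) h) (nonlin F J w w + blinfun_apply (J w) w)"

definition stage3 ::
  "('a::banach \<Rightarrow> 'a) \<Rightarrow> ('a \<Rightarrow> 'a \<Rightarrow>\<^sub>L 'a) \<Rightarrow> ('a \<Rightarrow> real \<Rightarrow> 'a \<Rightarrow>\<^sub>L 'a) \<Rightarrow> real \<Rightarrow> 'a \<Rightarrow> 'a" where
  "stage3 F J S h w =
     w + h *\<^sub>R blinfun_apply (J w) (stage2 F J S h w) + h *\<^sub>R nonlin F J w w"

definition correction ::
  "('a::banach \<Rightarrow> 'a) \<Rightarrow> ('a \<Rightarrow> 'a \<Rightarrow>\<^sub>L 'a) \<Rightarrow> ('a \<Rightarrow> real \<Rightarrow> 'a \<Rightarrow>\<^sub>L 'a) \<Rightarrow> real \<Rightarrow> 'a \<Rightarrow> 'a" where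
  "correction F J S h w =
     - ((1/4) *\<^sub>R blinfun_apply (nonlin_deriv J w (stage2 F J S h w))
                  (stage3 F J S h w - 2 *\<^sub>R stage2 F J S h w + w))"

text \<open>The coefficients \<open>b1\<close>, \<open>b2\<close>, \<open>b3\<close> are operator functions, evaluated at \<open>h J\<^sub>n\<close>.\<close>

definition DPG_step ::
  "('a::banach \<Rightarrow> 'a) \<Rightarrow> ('a \<Rightarrow> 'a \<Rightarrow>\<^sub>L 'a) \<Rightarrow> ('a \<Rightarrow> real \<Rightarrow> 'a \<Rightarrow>\<^sub>L 'a) \<Rightarrow>
   (('a \<Rightarrow>\<^sub>L 'a) \<Rightarrow> ('a \<Rightarrow>\<^sub>L 'a)) \<Rightarrow> (('a \<Rightarrow>\<^sub>L 'a) \<Rightarrow> ('a \<Rightarrow>\<^sub>L 'a)) \<Rightarrow> (('a \<Rightarrow>\<^sub>L 'a) \<Rightarrow> ('a \<Rightarrow>\<^sub>L 'a)) \<Rightarrow>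
   real \<Rightarrow> 'a \<Rightarrow> 'a" where
  "DPG_step F J S b1 b2 b3 h w =
     blinfun_apply (S w h) w
     + h *\<^sub>R blinfun_apply (b1 (h *\<^sub>R J w)) (nonlin F J w w)
     + h *\<^sub>R blinfun_apply (b2 (h *\<^sub>R J w))
              (nonlin F J w (stage2 F J S h w) + correction F J S h w)
     + h *\<^sub>R blinfun_apply (b3 (h *\<^sub>R J w)) (nonlin F J w (stage3 F J S h w))"

definition local_error ::
  "('a::banach \<Rightarrow> 'a) \<Rightarrow> ('a \<Rightarrow> 'a \<Rightarrow>\<^sub>L 'a) \<Rightarrow> ('a \<Rightarrow> real \<Rightarrow> 'a \<Rightarrow>\<^sub>L 'a) \<Rightarrow>
   (('a \<Rightarrow>\<^sub>L 'a) \<Rightarrow> ('a \<Rightarrow>\<^sub>L 'a)) \<Rightarrow> (('a \<Rightarrow>\<^sub>L 'a) \<Rightarrow> ('a \<Rightarrow>\<^sub>L 'a)) \<Rightarrow> (('a \<Rightarrow>\<^sub>L 'a) \<Rightarrow> ('a \<Rightarrow>\<^sub>L 'a)) \<Rightarrow>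
   (real \<Rightarrow> 'a) \<Rightarrow> real \<Rightarrow> nat \<Rightarrow> 'a" where
  "local_error F J S b1 b2 b3 u h n =
     DPG_step F J S b1 b2 b3 h (u (real n * h)) - u (real (Suc n) * h)"

end

theory Submission
  imports Defs
begin

text \<open>
  Write \<open>w = u t\<close>, \<open>A = J w\<close>, \<open>E = S w\<close>, \<open>f = F w\<close> and \<open>g v = F v - A v\<close>. The equation
  \<open>u' = A u + g u\<close> and variation of constants give
  \<open>u (t + h) = E h w + h \<integral>\<^sub>0\<^sup>1 E ((1 - \<theta>) h) (g (u (t + \<theta> h))) d\<theta>\<close>.
  Since the derivative of \<open>g\<close> vanishes at \<open>w\<close>, the function \<open>s \<mapsto> g (u (t + s))\<close> has no linear term:
  it equals \<open>g w + s\<^sup>2/2 g\<^sub>2 + s\<^sup>3/6 g\<^sub>3 + O(s\<^sup>4)\<close>, so up to \<open>O(h\<^sup>5)\<close> the solution is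
  \<open>E h w + h \<phi>\<^sub>1 (g w) + h\<^sup>3 \<phi>\<^sub>3 g\<^sub>2 + h\<^sup>4 \<phi>\<^sub>4 g\<^sub>3\<close> (lemmas \<open>g_expansion\<close> and
  \<open>exact_solution_expansion\<close>).

  The order conditions are made so that the method reproduces this expression once its second and
  third stage deliver \<open>g (u (t + h/2))\<close> and \<open>g (u (t + h))\<close> up to \<open>O(h\<^sup>4)\<close>. For the third stage
  this holds because it misses \<open>u (t + h)\<close> by \<open>O(h\<^sup>3)\<close> only, and the derivative of \<open>g\<close> near \<open>w\<close> adds
  another factor \<open>h\<close> (lemma \<open>g_stage3_expansion\<close>). The second stage misses \<open>u (t + h/2)\<close> by
  \<open>h\<^sup>2/24 A f + O(h\<^sup>3)\<close>, which spoils \<open>g\<close> by \<open>h\<^sup>3/48 D2 w f (A f)\<close>; exactly this term is removed by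
  the correction factor, since the second difference of the stages is \<open>h\<^sup>2/6 A f + O(h\<^sup>3)\<close> (lemmas
  \<open>g_stage2\<close> and \<open>correction_expansion\<close>).

  The operators \<open>J v\<close> are bounded, with a common bound. Hence all expansions are in powers of \<open>h\<close>
  itself, and the semigroups are differentiable in operator norm. The solution runs through a compact
  set and the bounds on \<open>F\<close>, its derivatives and the semigroups hold along all of it; therefore the
  error constants can be chosen independent of \<open>t\<close>, which the predicate \<open>unif_O\<close> keeps track of.
\<close>

section \<open>Semigroups with a bounded generator\<close>

text \<open>
  On the bounded time interval \<open>[0, b]\<close> a constant replaces the exponential growth bound. Later one
  \<open>B\<close> serves the semigroups of all points of the solution, so that estimates in terms of \<open>B\<close> and
  \<open>norm A\<close> are uniform.
\<close>
locale bounded_generator =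
  fixes A :: "'a::banach \<Rightarrow>\<^sub>L 'a" and E :: "real \<Rightarrow> 'a \<Rightarrow>\<^sub>L 'a" and b B :: real
  assumes gen: "generates A E"
    and b_nonneg: "0 \<le> b"
    and E_bound: "\<And>t. 0 \<le> t \<Longrightarrow> t \<le> b \<Longrightarrow> norm (E t) \<le> B"
begin

lemma E_0 [simp]: "E 0 = id_blinfun"
  using gen by (simp add: generates_def C0_semigroup_def)

lemma E_add: "0 \<le> s \<Longrightarrow> 0 \<le> t \<Longrightarrow> E (s + t) = E s o\<^sub>L E t"
  using gen by (simp add: generates_def C0_semigroup_def)

lemma B_nonneg: "0 \<le> B"
  using E_bound[of 0] b_nonneg norm_ge_zero[of "E 0"] by linarith

lemma E_apply_bound: "0 \<le> t \<Longrightarrow> t \<le> b \<Longrightarrow> norm (E t x) \<le> B * norm x"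
  using norm_blinfun[of "E t" x] E_bound[of t] mult_right_mono[of "norm (E t)" B "norm x"]
  by fastforce

text \<open>
  Both orders of \<open>s\<close> and \<open>t\<close> are covered by one formula, so that the right-sided limits at zero in the
  definition of the generator yield two-sided continuity and differentiability at every time.
\<close>
lemma E_diff_factor:
  assumes "0 \<le> s" "0 \<le> t"
  shows "E s x - E t x = sgn (s - t) *\<^sub>R E (min s t) (E \<bar>s - t\<bar> x - x)"
proof (cases s t rule: linorder_cases)
  case less
  then show ?thesis
    using E_add[of s "t - s"] assms by (simp add: blinfun.diff_right)
next
  case greater
  then show ?thesis
    using E_add[of t "s - t"] assms by (simp add: blinfun.diff_right)
qed simp

lemma gap_filterlim: "filterlim (\<lambda>s. \<bar>s - t\<bar>) (at_right 0) (at t within S)" for t :: real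
  unfolding filterlim_at
proof
  show "\<forall>\<^sub>F s in at t within S. \<bar>s - t\<bar> \<in> {0<..} \<and> \<bar>s - t\<bar> \<noteq> 0"
    by (auto simp: eventually_at_filter)
  have "((\<lambda>s. \<bar>s - t\<bar>) \<longlongrightarrow> \<bar>t - t\<bar>) (at t within S)"
    by (intro tendsto_intros)
  then show "((\<lambda>s. \<bar>s - t\<bar>) \<longlongrightarrow> 0) (at t within S)" by simp
qed

lemma E_strong_tendsto:
  assumes t: "t \<in> {0..b}"
  shows "((\<lambda>s. E s x - E t x) \<longlongrightarrow> 0) (at t within {0..b})"
proof (rule Lim_null_comparison)
  show "\<forall>\<^sub>F s in at t within {0..b}. norm (E s x - E t x) \<le> B * norm (E \<bar>s - t\<bar> x - x)"
    unfolding eventually_at_filter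
  proof (rule always_eventually, intro allI impI)
    fix s assume s: "s \<noteq> t" "s \<in> {0..b}"
    have "norm (E (min s t) (E \<bar>s - t\<bar> x - x)) \<le> B * norm (E \<bar>s - t\<bar> x - x)"
      using s t by (intro E_apply_bound) auto
    then show "norm (E s x - E t x) \<le> B * norm (E \<bar>s - t\<bar> x - x)"
      using s t by (subst E_diff_factor) (auto simp: sgn_real_def)
  qed
  have "((\<lambda>t. E t x) \<longlongrightarrow> x) (at_right 0)"
    using gen by (simp add: generates_def C0_semigroup_def)
  from filterlim_compose[OF this gap_filterlim]
  have "((\<lambda>s. B * norm (E \<bar>s - t\<bar> x - x)) \<longlongrightarrow> B * norm (x - x)) (at t within {0..b})"
    by (intro tendsto_intros)
  then show "((\<lambda>s. B * norm (E \<bar>s - t\<bar> x - x)) \<longlongrightarrow> 0) (at t within {0..b})"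
    by simp
qed

lemma E_strong_derivative:
  assumes t: "t \<in> {0..b}"
  shows "((\<lambda>s. E s x) has_vector_derivative E t (A x)) (at t within {0..b})"
proof -
  define Q where "Q = (\<lambda>\<tau>. (E \<tau> x - x) /\<^sub>R \<tau>)"
  have "(Q \<longlongrightarrow> A x) (at_right 0)"
    using gen by (simp add: generates_def Q_def)
  from filterlim_compose[OF this gap_filterlim]
  have Q: "((\<lambda>s. Q \<bar>s - t\<bar>) \<longlongrightarrow> A x) (at t within {0..b})" .
  have lim: "((\<lambda>s. (E s x - E t x) /\<^sub>R (s - t) - E t (A x)) \<longlongrightarrow> 0) (at t within {0..b})"
  proof (rule Lim_null_comparison)
    show "\<forall>\<^sub>F s in at t within {0..b}. norm ((E s x - E t x) /\<^sub>R (s - t) - E t (A x))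
        \<le> B * norm (Q \<bar>s - t\<bar> - A x) + norm (E s (A x) - E t (A x))"
      unfolding eventually_at_filter
    proof (rule always_eventually, intro allI impI)
      fix s assume s: "s \<noteq> t" "s \<in> {0..b}"
      have "(E s x - E t x) /\<^sub>R (s - t) = E (min s t) (Q \<bar>s - t\<bar>)"
        using s t E_diff_factor[of s t x]
        by (auto simp: Q_def blinfun.scaleR_right sgn_real_def abs_real_def
            simp flip: scaleR_minus_left inverse_minus_eq)
      then have "(E s x - E t x) /\<^sub>R (s - t) - E t (A x)
          = E (min s t) (Q \<bar>s - t\<bar> - A x) + (E (min s t) (A x) - E t (A x))"
        by (simp add: blinfun.diff_right)
      also have "norm \<dots> \<le> norm (E (min s t) (Q \<bar>s - t\<bar> - A x))
          + norm (E (min s t) (A x) - E t (A x))"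
        by (rule norm_triangle_ineq)
      also have "norm (E (min s t) (Q \<bar>s - t\<bar> - A x)) \<le> B * norm (Q \<bar>s - t\<bar> - A x)"
        using s t by (intro E_apply_bound) auto
      also have "norm (E (min s t) (A x) - E t (A x)) \<le> norm (E s (A x) - E t (A x))"
        by (simp add: min_def)
      finally show "norm ((E s x - E t x) /\<^sub>R (s - t) - E t (A x))
        \<le> B * norm (Q \<bar>s - t\<bar> - A x) + norm (E s (A x) - E t (A x))" by simp
    qed
    have "((\<lambda>s. B * norm (Q \<bar>s - t\<bar> - A x) + norm (E s (A x) - E t (A x))) \<longlongrightarrow>
        B * norm (A x - A x) + norm (0::'a)) (at t within {0..b})"
      by (intro tendsto_intros Q E_strong_tendsto t)
    then show "((\<lambda>s. B * norm (Q \<bar>s - t\<bar> - A x) + norm (E s (A x) - E t (A x))) \<longlongrightarrow> 0)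
        (at t within {0..b})" by simp
  qed
  have "norm ((1 / norm (s - t)) *\<^sub>R (E s x - (E t x + (s - t) *\<^sub>R E t (A x))))
      \<le> norm ((E s x - E t x) /\<^sub>R (s - t) - E t (A x))" if "s \<noteq> t" for s
  proof -
    have "E s x - (E t x + (s - t) *\<^sub>R E t (A x))
        = (s - t) *\<^sub>R ((E s x - E t x) /\<^sub>R (s - t) - E t (A x))"
      using that by (simp add: scaleR_diff_right[of "s - t"] diff_diff_eq)
    then show ?thesis using that by simp
  qed
  then have ev: "\<forall>\<^sub>F s in at t within {0..b}.
      norm ((1 / norm (s - t)) *\<^sub>R (E s x - (E t x + (s - t) *\<^sub>R E t (A x))))
      \<le> norm ((E s x - E t x) /\<^sub>R (s - t) - E t (A x))"
    unfolding eventually_at_filter by (intro always_eventually) blast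
  show ?thesis
    unfolding has_vector_derivative_def has_derivative_within
    by (intro conjI bounded_linear_scaleR_left Lim_null_comparison[OF ev tendsto_norm_zero[OF lim]])
qed

text \<open>
  Here boundedness of \<open>A\<close> enters: the strong derivative \<open>E t (A x)\<close> is bounded by a multiple of
  \<open>norm x\<close>, which turns strong continuity into continuity in operator norm.
\<close>
lemma E_lipschitz:
  assumes s: "s \<in> {0..b}" and t: "t \<in> {0..b}"
  shows "norm (E s - E t) \<le> B * norm A * \<bar>s - t\<bar>"
proof (rule norm_blinfun_bound)
  show "0 \<le> B * norm A * \<bar>s - t\<bar>" using B_nonneg by simp
  fix x
  have "norm (E s x - E t x) \<le> (B * norm A * norm x) * norm (s - t)"
  proof (rule differentiable_bound[OF convex_real_interval(5)])
    fix \<sigma> assume \<sigma>: "\<sigma> \<in> {0..b}"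
    show "((\<lambda>s. E s x) has_derivative (\<lambda>c. c *\<^sub>R E \<sigma> (A x))) (at \<sigma> within {0..b})"
      using E_strong_derivative[OF \<sigma>] by (simp add: has_vector_derivative_def)
    have "norm (E \<sigma> (A x)) \<le> B * norm (A x)" using \<sigma> by (intro E_apply_bound) auto
    also have "\<dots> \<le> B * (norm A * norm x)" using B_nonneg by (intro mult_left_mono norm_blinfun)
    finally show "onorm (\<lambda>c. c *\<^sub>R E \<sigma> (A x)) \<le> B * norm A * norm x"
      by (intro onorm_le) (simp add: mult_left_mono mult.commute[of _ "\<bar>_\<bar>"])
  qed (use s t in auto)
  then show "norm ((E s - E t) x) \<le> B * norm A * \<bar>s - t\<bar> * norm x"
    by (simp add: blinfun.diff_left mult_ac)
qed

lemma E_linearization: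
  assumes s: "s \<in> {0..b}" and t: "t \<in> {0..b}"
  shows "norm (E s - E t - (s - t) *\<^sub>R (E t o\<^sub>L A)) \<le> B * (norm A)\<^sup>2 * (s - t)\<^sup>2"
proof (rule norm_blinfun_bound)
  show "0 \<le> B * (norm A)\<^sup>2 * (s - t)\<^sup>2" using B_nonneg by simp
  fix x
  have sub: "closed_segment t s \<subseteq> {0..b}" using s t by (auto simp: closed_segment_eq_real_ivl)
  have "norm (E s x - E t x - (s - t) *\<^sub>R E t (A x)) \<le>
     norm (s - t) * (B * norm A * \<bar>s - t\<bar> * (norm A * norm x))"
  proof (rule vector_differentiable_bound_linearization)
    show "closed_segment t s \<subseteq> closed_segment t s" ..
    show "t \<in> closed_segment t s" by simp
    fix \<sigma> assume "\<sigma> \<in> closed_segment t s"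
    then have \<sigma>: "\<sigma> \<in> {0..b}" "\<bar>\<sigma> - t\<bar> \<le> \<bar>s - t\<bar>"
      using sub by (auto simp: closed_segment_eq_real_ivl split: if_splits)
    show "((\<lambda>s. E s x) has_vector_derivative E \<sigma> (A x)) (at \<sigma> within closed_segment t s)"
      using E_strong_derivative[OF \<sigma>(1)] sub by (rule has_vector_derivative_within_subset)
    have "norm ((E \<sigma> - E t) (A x)) \<le> norm (E \<sigma> - E t) * norm (A x)"
      by (rule norm_blinfun)
    also have "\<dots> \<le> (B * norm A * \<bar>s - t\<bar>) * (norm A * norm x)"
      by (intro mult_mono norm_blinfun order_trans[OF E_lipschitz[OF \<sigma>(1) t]] mult_left_mono \<sigma>)
        (auto simp: B_nonneg)
    finally show "norm (E \<sigma> (A x) - E t (A x)) \<le> B * norm A * \<bar>s - t\<bar> * (norm A * norm x)"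
      by (simp add: blinfun.diff_left)
  qed
  then show "norm ((E s - E t - (s - t) *\<^sub>R (E t o\<^sub>L A)) x) \<le> B * (norm A)\<^sup>2 * (s - t)\<^sup>2 * norm x"
    by (simp add: blinfun.diff_left blinfun.scaleR_left power2_eq_square mult_ac)
qed

text \<open>
  Differentiability in norm gives access to the product rule for \<open>\<theta> \<mapsto> E ((1 - \<theta>) h) (y \<theta>)\<close>,
  the step behind variation of constants.
\<close>
lemma E_derivative:
  assumes t: "t \<in> {0..b}"
  shows "(E has_vector_derivative (E t o\<^sub>L A)) (at t within {0..b})"
  unfolding has_vector_derivative_def has_derivative_within
proof (intro conjI bounded_linear_scaleR_left, rule Lim_null_comparison)
  show "\<forall>\<^sub>F s in at t within {0..b}. norm ((1 / norm (s - t)) *\<^sub>R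
      (E s - (E t + (s - t) *\<^sub>R (E t o\<^sub>L A)))) \<le> B * (norm A)\<^sup>2 * \<bar>s - t\<bar>"
    unfolding eventually_at_filter
  proof (rule always_eventually, intro allI impI)
    fix s assume s: "s \<noteq> t" "s \<in> {0..b}"
    have "norm (E s - (E t + (s - t) *\<^sub>R (E t o\<^sub>L A))) \<le> B * (norm A)\<^sup>2 * \<bar>s - t\<bar> * \<bar>s - t\<bar>"
      using E_linearization[OF s(2) t] by (simp add: diff_diff_eq power2_eq_square mult_ac)
    then show "norm ((1 / norm (s - t)) *\<^sub>R (E s - (E t + (s - t) *\<^sub>R (E t o\<^sub>L A))))
        \<le> B * (norm A)\<^sup>2 * \<bar>s - t\<bar>"
      using s(1) by (simp add: divide_simps)
  qed
  have "((\<lambda>s. B * (norm A)\<^sup>2 * \<bar>s - t\<bar>) \<longlongrightarrow> B * (norm A)\<^sup>2 * \<bar>t - t\<bar>) (at t within {0..b})"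
    by (intro tendsto_intros)
  then show "((\<lambda>s. B * (norm A)\<^sup>2 * \<bar>s - t\<bar>) \<longlongrightarrow> 0) (at t within {0..b})" by simp
qed

lemma E_continuous: "continuous_on {0..b} E"
  unfolding continuous_on_eq_continuous_within
  by (blast intro: has_vector_derivative_continuous E_derivative)

lemma reversed_time_le:
  fixes \<theta> h :: real
  assumes "0 \<le> h" "\<theta> \<in> {0..1}"
  shows "0 \<le> (1 - \<theta>) * h" "(1 - \<theta>) * h \<le> h"
  using assms by (auto intro: mult_left_le_one_le)

lemma reversed_continuous:
  assumes "0 \<le> h" "h \<le> b"
  shows "continuous_on {0..1} (\<lambda>\<theta>. E ((1 - \<theta>) * h))"
proof (rule continuous_on_compose2[OF E_continuous])
  show "(\<lambda>\<theta>. (1 - \<theta>) * h) ` {0..1} \<subseteq> {0..b}"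
    using assms reversed_time_le[OF assms(1)] by fastforce
qed (intro continuous_intros)

text \<open>
  By continuity in norm the pointwise integral is the application of an operator-valued integral.
  In particular it is a bounded operator, so \<open>Blinfun\<close> in the definition of \<open>phi\<close> does not fall back
  to an unspecified value.
\<close>
lemma phi_eq_integral:
  assumes h: "0 \<le> h" "h \<le> b" and p: "p \<noteq> 0"
  shows "phi p E h = integral {0..1} (\<lambda>\<theta>. (\<theta> ^ (p - 1) / fact (p - 1)) *\<^sub>R E ((1 - \<theta>) * h))"
proof -
  have "(\<lambda>\<theta>. (\<theta> ^ (p - 1) / fact (p - 1)) *\<^sub>R E ((1 - \<theta>) * h)) integrable_on {0..1}"
    by (intro integrable_continuous_real continuous_intros reversed_continuous h) auto
  from blinfun_apply_integral[OF this]
  have "(\<lambda>x. integral {0..1} (\<lambda>\<theta>. (\<theta> ^ (p - 1) / fact (p - 1)) *\<^sub>R E ((1 - \<theta>) * h) x))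
      = blinfun_apply (integral {0..1} (\<lambda>\<theta>. (\<theta> ^ (p - 1) / fact (p - 1)) *\<^sub>R E ((1 - \<theta>) * h)))"
    by (intro ext) (simp add: blinfun.scaleR_left)
  then show ?thesis
    using p by (simp only: phi_def if_False blinfun_apply_inverse)
qed

lemma phi_apply_has_integral:
  assumes h: "0 \<le> h" "h \<le> b" and p: "p \<noteq> 0"
  shows "((\<lambda>\<theta>. (\<theta> ^ (p - 1) / fact (p - 1)) *\<^sub>R E ((1 - \<theta>) * h) x) has_integral phi p E h x) {0..1}"
proof -
  have "((\<lambda>\<theta>. (\<theta> ^ (p - 1) / fact (p - 1)) *\<^sub>R E ((1 - \<theta>) * h)) has_integral phi p E h) {0..1}"
    unfolding phi_eq_integral[OF assms]
    by (intro integrable_integral integrable_continuous_real continuous_intros reversed_continuous h) auto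
  from has_integral_linear[OF this blinfun.bounded_linear_left[of x]]
  show ?thesis by (simp add: o_def blinfun.scaleR_left)
qed

lemma phi_bound:
  assumes h: "0 \<le> h" "h \<le> b" and p: "p \<noteq> 0"
  shows "norm (phi p E h) \<le> B"
proof -
  have "norm (integral {0..1} (\<lambda>\<theta>. (\<theta> ^ (p - 1) / fact (p - 1)) *\<^sub>R E ((1 - \<theta>) * h))) \<le> B * (1 - 0)"
  proof (rule integral_bound)
    show "continuous_on {0..1} (\<lambda>\<theta>. (\<theta> ^ (p - 1) / fact (p - 1)) *\<^sub>R E ((1 - \<theta>) * h))"
      by (intro continuous_intros reversed_continuous h) auto
    fix \<theta> :: real assume \<theta>: "\<theta> \<in> {0..1}"
    have "\<theta> ^ (p - 1) / fact (p - 1) \<le> 1"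
      using \<theta> order_trans[OF power_le_one[of \<theta> "p - 1"] fact_ge_1[of "p - 1", where 'a=real]]
      by (simp add: divide_le_eq)
    moreover have "norm (E ((1 - \<theta>) * h)) \<le> B"
      using h reversed_time_le[OF h(1) \<theta>] by (intro E_bound) auto
    ultimately have "(\<theta> ^ (p - 1) / fact (p - 1)) * norm (E ((1 - \<theta>) * h)) \<le> 1 * B"
      using \<theta> by (intro mult_mono) auto
    then show "norm ((\<theta> ^ (p - 1) / fact (p - 1)) *\<^sub>R E ((1 - \<theta>) * h)) \<le> B"
      using \<theta> by simp
  qed simp
  then show ?thesis using assms by (simp add: phi_eq_integral)
qed

text \<open>
  Integrate \<open>\<theta> E ((1 - \<theta>) h) = \<theta> (1 + (1 - \<theta>) h A) + O(h\<^sup>2)\<close>; the moments are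
  \<open>\<integral> \<theta> = 1/2\<close> and \<open>\<integral> \<theta> (1 - \<theta>) = 1/6\<close>.
\<close>
lemma phi_2_expansion:
  assumes h: "0 \<le> h" "h \<le> b"
  shows "norm (phi 2 E h - (1/2) *\<^sub>R id_blinfun - (h/6) *\<^sub>R A) \<le> B * (norm A)\<^sup>2 * h\<^sup>2"
proof -
  define R where "R = (\<lambda>\<theta>. \<theta> *\<^sub>R (E ((1 - \<theta>) * h) - id_blinfun - ((1 - \<theta>) * h) *\<^sub>R A))"
  have cont: "continuous_on {0..1} R"
    unfolding R_def by (intro continuous_intros reversed_continuous h)
  have "((\<lambda>\<theta>. \<theta> *\<^sub>R id_blinfun + (\<theta> * (1 - \<theta>) * h) *\<^sub>R A) has_integral
     ((1/2) *\<^sub>R id_blinfun + (h/2 - h/3) *\<^sub>R A) - ((0\<^sup>2/2) *\<^sub>R id_blinfun + (h * 0\<^sup>2/2 - h * 0 ^ 3/3) *\<^sub>R A)) {0..1}"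
    using fundamental_theorem_of_calculus[of 0 1
        "\<lambda>\<theta>. (\<theta>\<^sup>2/2) *\<^sub>R id_blinfun + (h * \<theta>\<^sup>2/2 - h * \<theta> ^ 3/3) *\<^sub>R A"
        "\<lambda>\<theta>. \<theta> *\<^sub>R id_blinfun + (\<theta> * (1 - \<theta>) * h) *\<^sub>R A"]
    by (simp, elim meta_mp) (auto intro!: derivative_eq_intros
        simp flip: has_real_derivative_iff_has_vector_derivative
        simp: algebra_simps power2_eq_square)
  moreover have "(R has_integral integral {0..1} R) {0..1}"
    using cont by (intro integrable_integral integrable_continuous_real)
  ultimately have "((\<lambda>\<theta>. R \<theta> + (\<theta> *\<^sub>R id_blinfun + (\<theta> * (1 - \<theta>) * h) *\<^sub>R A)) has_integral
     integral {0..1} R + (((1/2) *\<^sub>R id_blinfun + (h/2 - h/3) *\<^sub>R A)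
       - ((0\<^sup>2/2) *\<^sub>R id_blinfun + (h * 0\<^sup>2/2 - h * 0 ^ 3/3) *\<^sub>R A))) {0..1}"
    by (intro has_integral_add)
  moreover have "R \<theta> + (\<theta> *\<^sub>R id_blinfun + (\<theta> * (1 - \<theta>) * h) *\<^sub>R A) = \<theta> *\<^sub>R E ((1 - \<theta>) * h)" for \<theta>
    by (simp add: R_def scaleR_diff_right)
  ultimately have "integral {0..1} (\<lambda>\<theta>. \<theta> *\<^sub>R E ((1 - \<theta>) * h))
     = integral {0..1} R + ((1/2) *\<^sub>R id_blinfun + (h/2 - h/3) *\<^sub>R A)"
    by (simp add: integral_unique)
  then have "phi 2 E h - (1/2) *\<^sub>R id_blinfun - (h/6) *\<^sub>R A = integral {0..1} R"
    using h by (simp add: phi_eq_integral)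
  also have "norm \<dots> \<le> B * (norm A)\<^sup>2 * h\<^sup>2 * (1 - 0)"
  proof (rule integral_bound[OF _ cont])
    fix \<theta> :: real assume \<theta>: "\<theta> \<in> {0..1}"
    have le: "(1 - \<theta>) * h \<le> h" using \<theta> h by (intro mult_left_le_one_le) auto
    have "norm (E ((1 - \<theta>) * h) - E 0 - ((1 - \<theta>) * h - 0) *\<^sub>R (E 0 o\<^sub>L A))
        \<le> B * (norm A)\<^sup>2 * ((1 - \<theta>) * h - 0)\<^sup>2"
      using \<theta> h le by (intro E_linearization) auto
    also have "E 0 o\<^sub>L A = A" by (rule blinfun_eqI) simp
    also have "B * (norm A)\<^sup>2 * ((1 - \<theta>) * h - 0)\<^sup>2 \<le> B * (norm A)\<^sup>2 * h\<^sup>2"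
      using \<theta> h le B_nonneg by (intro mult_left_mono power_mono) auto
    finally have "\<theta> * norm (E ((1 - \<theta>) * h) - id_blinfun - ((1 - \<theta>) * h) *\<^sub>R A)
        \<le> 1 * (B * (norm A)\<^sup>2 * h\<^sup>2)"
      using \<theta> by (intro mult_mono) auto
    then show "norm (R \<theta>) \<le> B * (norm A)\<^sup>2 * h\<^sup>2"
      using \<theta> by (simp add: R_def)
  qed simp
  finally show ?thesis by simp
qed

end

section \<open>Uniform order of magnitude\<close>

text \<open>
  \<open>unif_O T k f\<close> says \<open>f t s = O(s\<^sup>k)\<close> as \<open>s\<close> tends to zero, uniformly over all steps of length \<open>s\<close>
  from \<open>t\<close> that stay in \<open>[0, T]\<close>. The threshold \<open>h0\<close> is existential, so that smallness of \<open>s\<close>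
  needed to stay in a neighbourhood of the solution never has to be recorded.
\<close>
definition unif_O :: "real \<Rightarrow> nat \<Rightarrow> (real \<Rightarrow> real \<Rightarrow> 'b::real_normed_vector) \<Rightarrow> bool" where
  "unif_O T k f \<longleftrightarrow> (\<exists>K. \<exists>h0>0. \<forall>t s. 0 \<le> t \<longrightarrow> 0 \<le> s \<longrightarrow> t + s \<le> T \<longrightarrow> s \<le> h0
     \<longrightarrow> norm (f t s) \<le> K * s ^ k)"

lemma unif_OI:
  assumes "h0 > 0"
    and "\<And>t s. \<lbrakk>0 \<le> t; 0 \<le> s; t + s \<le> T; s \<le> h0\<rbrakk> \<Longrightarrow> norm (f t s) \<le> K * s ^ k"
  shows "unif_O T k f"
  using assms unfolding unif_O_def by blast

lemma unif_OE:
  assumes "unif_O T k f"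
  obtains K h0 where "0 \<le> K" "0 < h0" "h0 \<le> 1"
    "\<And>t s. \<lbrakk>0 \<le> t; 0 \<le> s; t + s \<le> T; s \<le> h0\<rbrakk> \<Longrightarrow> norm (f t s) \<le> K * s ^ k"
proof -
  obtain K h0 where h0: "h0 > 0" and
    K: "\<And>t s. \<lbrakk>0 \<le> t; 0 \<le> s; t + s \<le> T; s \<le> h0\<rbrakk> \<Longrightarrow> norm (f t s) \<le> K * s ^ k"
    using assms unfolding unif_O_def by blast
  show thesis
  proof (rule that[of "\<bar>K\<bar>" "min h0 1"])
    fix t s :: real assume *: "0 \<le> t" "0 \<le> s" "t + s \<le> T" "s \<le> min h0 1"
    then have "norm (f t s) \<le> K * s ^ k" using K by simp
    also have "\<dots> \<le> \<bar>K\<bar> * s ^ k" using * by (intro mult_right_mono) auto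
    finally show "norm (f t s) \<le> \<bar>K\<bar> * s ^ k" .
  qed (use h0 in auto)
qed

lemma unif_O_cong:
  assumes "unif_O T k f" and "\<And>t s. f t s = g t s"
  shows "unif_O T k g"
  using assms by (simp add: unif_O_def)

lemma unif_O_mono:
  assumes f: "unif_O T k f" and "l \<le> k"
  shows "unif_O T l f"
proof -
  obtain K h0 where K: "0 \<le> K" "0 < h0" "h0 \<le> 1"
    "\<And>t s. \<lbrakk>0 \<le> t; 0 \<le> s; t + s \<le> T; s \<le> h0\<rbrakk> \<Longrightarrow> norm (f t s) \<le> K * s ^ k"
    using that by (rule unif_OE[OF f])
  show ?thesis
  proof (rule unif_OI[OF K(2)])
    fix t s :: real assume *: "0 \<le> t" "0 \<le> s" "t + s \<le> T" "s \<le> h0"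
    have "norm (f t s) \<le> K * s ^ k" using * K by simp
    also have "\<dots> \<le> K * s ^ l"
      using * K assms by (intro mult_left_mono power_decreasing) auto
    finally show "norm (f t s) \<le> K * s ^ l" .
  qed
qed

lemma unif_O_dominated:
  assumes f: "unif_O T k f" and "h1 > 0"
    and le: "\<And>t s. \<lbrakk>0 \<le> t; 0 \<le> s; t + s \<le> T; s \<le> h1\<rbrakk> \<Longrightarrow> norm (g t s) \<le> L * norm (f t s) ^ m"
    and n: "n \<le> k * m"
  shows "unif_O T n g"
proof (rule unif_O_mono[OF _ n])
  obtain K h0 where K: "0 \<le> K" "0 < h0" "h0 \<le> 1"
    "\<And>t s. \<lbrakk>0 \<le> t; 0 \<le> s; t + s \<le> T; s \<le> h0\<rbrakk> \<Longrightarrow> norm (f t s) \<le> K * s ^ k"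
    using that by (rule unif_OE[OF f])
  show "unif_O T (k * m) g"
  proof (rule unif_OI[of "min h0 h1"])
    fix t s :: real assume *: "0 \<le> t" "0 \<le> s" "t + s \<le> T" "s \<le> min h0 h1"
    have "norm (g t s) \<le> L * norm (f t s) ^ m" using * le by simp
    also have "\<dots> \<le> \<bar>L\<bar> * norm (f t s) ^ m" by (intro mult_right_mono) auto
    also have "\<dots> \<le> \<bar>L\<bar> * (K * s ^ k) ^ m"
      using * K by (intro mult_left_mono power_mono) auto
    finally show "norm (g t s) \<le> (\<bar>L\<bar> * K ^ m) * s ^ (k * m)"
      by (simp add: power_mult_distrib power_mult mult_ac)
  qed (use K assms in auto)
qed

lemma unif_O_bounded:
  assumes "\<And>t s. \<lbrakk>0 \<le> t; 0 \<le> s; t + s \<le> T\<rbrakk> \<Longrightarrow> norm (f t s) \<le> K"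
  shows "unif_O T 0 f"
  using assms by (intro unif_OI[of 1]) auto

lemma unif_O_power: "unif_O T k (\<lambda>t s. c * s ^ k :: real)"
  by (intro unif_OI[of 1 _ _ "\<bar>c\<bar>"]) (auto simp: abs_mult)

lemma unif_O_add:
  assumes f: "unif_O T k f" and g: "unif_O T k g"
  shows "unif_O T k (\<lambda>t s. f t s + g t s)"
proof -
  obtain K h0 where K: "0 \<le> K" "0 < h0" "h0 \<le> 1"
    "\<And>t s. \<lbrakk>0 \<le> t; 0 \<le> s; t + s \<le> T; s \<le> h0\<rbrakk> \<Longrightarrow> norm (f t s) \<le> K * s ^ k"
    using that by (rule unif_OE[OF f])
  obtain L h1 where L: "0 \<le> L" "0 < h1" "h1 \<le> 1"
    "\<And>t s. \<lbrakk>0 \<le> t; 0 \<le> s; t + s \<le> T; s \<le> h1\<rbrakk> \<Longrightarrow> norm (g t s) \<le> L * s ^ k"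
    using that by (rule unif_OE[OF g])
  show ?thesis
  proof (rule unif_OI[of "min h0 h1"])
    fix t s :: real assume "0 \<le> t" "0 \<le> s" "t + s \<le> T" "s \<le> min h0 h1"
    then have "norm (f t s) + norm (g t s) \<le> K * s ^ k + L * s ^ k"
      using K L by (intro add_mono) auto
    then show "norm (f t s + g t s) \<le> (K + L) * s ^ k"
      by (simp add: distrib_right order_trans[OF norm_triangle_ineq])
  qed (use K L in auto)
qed

lemma unif_O_bilinear:
  assumes p: "bounded_bilinear p" and f: "unif_O T k f" and g: "unif_O T l g" and m: "m \<le> k + l"
  shows "unif_O T m (\<lambda>t s. p (f t s) (g t s))"
proof (rule unif_O_mono[OF _ m])
  obtain K h0 where K: "0 \<le> K" "0 < h0" "h0 \<le> 1"
    "\<And>t s. \<lbrakk>0 \<le> t; 0 \<le> s; t + s \<le> T; s \<le> h0\<rbrakk> \<Longrightarrow> norm (f t s) \<le> K * s ^ k"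
    using that by (rule unif_OE[OF f])
  obtain L h1 where L: "0 \<le> L" "0 < h1" "h1 \<le> 1"
    "\<And>t s. \<lbrakk>0 \<le> t; 0 \<le> s; t + s \<le> T; s \<le> h1\<rbrakk> \<Longrightarrow> norm (g t s) \<le> L * s ^ l"
    using that by (rule unif_OE[OF g])
  obtain N where N: "0 \<le> N" "\<And>x y. norm (p x y) \<le> norm x * norm y * N"
    using bounded_bilinear.nonneg_bounded[OF p] by blast
  show "unif_O T (k + l) (\<lambda>t s. p (f t s) (g t s))"
  proof (rule unif_OI[of "min h0 h1"])
    fix t s :: real assume *: "0 \<le> t" "0 \<le> s" "t + s \<le> T" "s \<le> min h0 h1"
    have "norm (p (f t s) (g t s)) \<le> norm (f t s) * norm (g t s) * N" by (rule N)
    also have "\<dots> \<le> (K * s ^ k) * (L * s ^ l) * N"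
      using * K L N by (intro mult_right_mono mult_mono) auto
    finally show "norm (p (f t s) (g t s)) \<le> (K * L * N) * s ^ (k + l)"
      by (simp add: power_add mult_ac)
  qed (use K L in auto)
qed

lemmas unif_O_apply = unif_O_bilinear[OF bounded_bilinear_blinfun_apply]

text \<open>
  Coefficients have the shape \<open>c * s ^ l\<close> to be found by unification, also where \<open>c = 1\<close> or \<open>l = 1\<close>.
\<close>
lemma unif_O_scaleR_power:
  assumes "unif_O T k f" "m \<le> l + k"
  shows "unif_O T m (\<lambda>t s. (c * s ^ l) *\<^sub>R f t s)"
  by (rule unif_O_bilinear[OF bounded_bilinear_scaleR unif_O_power assms])

lemma unif_O_scaleR: "unif_O T k f \<Longrightarrow> unif_O T k (\<lambda>t s. c *\<^sub>R f t s)"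
  using unif_O_scaleR_power[of T k f k 0 c] by simp

lemma unif_O_zero: "unif_O T k (\<lambda>t s. 0)"
  by (rule unif_OI[of 1 _ _ 0]) auto

lemma unif_O_minus: "unif_O T k f \<Longrightarrow> unif_O T k (\<lambda>t s. - f t s)"
  by (simp add: unif_O_def)

lemma unif_O_diff:
  "unif_O T k f \<Longrightarrow> unif_O T k g \<Longrightarrow> unif_O T k (\<lambda>t s. f t s - g t s)"
  using unif_O_add[OF _ unif_O_minus[where f = g]] by simp

text \<open>Guarantees that perturbed points lie in the strip where \<open>F\<close> is smooth.\<close>
lemma unif_O_small:
  assumes f: "unif_O T k f" and "k > 0" "r > 0"
  obtains h0 where "h0 > 0"
    "\<And>t s. \<lbrakk>0 \<le> t; 0 \<le> s; t + s \<le> T; s \<le> h0\<rbrakk> \<Longrightarrow> norm (f t s) < r"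
proof -
  have f1: "unif_O T 1 f" using unif_O_mono[OF f, of 1] \<open>k > 0\<close> by simp
  obtain K h0 where K: "0 \<le> K" "0 < h0" "h0 \<le> 1"
    "\<And>t s. \<lbrakk>0 \<le> t; 0 \<le> s; t + s \<le> T; s \<le> h0\<rbrakk> \<Longrightarrow> norm (f t s) \<le> K * s ^ 1"
    using that by (rule unif_OE[OF f1])
  show thesis
  proof (rule that[of "min h0 (r / (K + 1))"])
    fix t s :: real assume *: "0 \<le> t" "0 \<le> s" "t + s \<le> T" "s \<le> min h0 (r / (K + 1))"
    then have "norm (f t s) \<le> K * s" using K(4)[of t s] by simp
    also have "\<dots> \<le> K * (r / (K + 1))" using * K by (intro mult_left_mono) auto
    also have "\<dots> < r" using K \<open>r > 0\<close> by (simp add: field_simps)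
    finally show "norm (f t s) < r" .
  qed (use K \<open>r > 0\<close> in auto)
qed

lemma unif_O_half:
  assumes f: "unif_O T k f"
  shows "unif_O T k (\<lambda>t s. f t (s / 2))"
proof -
  obtain K h0 where K: "0 \<le> K" "0 < h0" "h0 \<le> 1"
    "\<And>t s. \<lbrakk>0 \<le> t; 0 \<le> s; t + s \<le> T; s \<le> h0\<rbrakk> \<Longrightarrow> norm (f t s) \<le> K * s ^ k"
    using that by (rule unif_OE[OF f])
  show ?thesis
  proof (rule unif_OI[OF K(2)])
    fix t s :: real assume *: "0 \<le> t" "0 \<le> s" "t + s \<le> T" "s \<le> h0"
    have "norm (f t (s / 2)) \<le> K * (s / 2) ^ k" using * by (intro K) auto
    also have "\<dots> \<le> K * s ^ k" using * K by (intro mult_left_mono power_mono) auto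
    finally show "norm (f t (s / 2)) \<le> K * s ^ k" .
  qed
qed

text \<open>
  The derivative is only required in the interior, because the differential equation says nothing
  at the end points of \<open>[0, T]\<close>.
\<close>
lemma unif_O_integrate:
  assumes z': "unif_O T k z'"
    and z0: "\<And>t. z t 0 = 0"
    and cont: "\<And>t. 0 \<le> t \<Longrightarrow> continuous_on {0..T - t} (z t)"
    and deriv: "\<And>t s. \<lbrakk>0 \<le> t; 0 < s; t + s < T\<rbrakk> \<Longrightarrow> (z t has_vector_derivative z' t s) (at s)"
  shows "unif_O T (Suc k) z"
proof -
  obtain K h0 where K: "0 \<le> K" "0 < h0" "h0 \<le> 1"
    "\<And>t s. \<lbrakk>0 \<le> t; 0 \<le> s; t + s \<le> T; s \<le> h0\<rbrakk> \<Longrightarrow> norm (z' t s) \<le> K * s ^ k"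
    using that by (rule unif_OE[OF z'])
  show ?thesis
  proof (rule unif_OI[OF K(2)])
    fix t s :: real assume *: "0 \<le> t" "0 \<le> s" "t + s \<le> T" "s \<le> h0"
    show "norm (z t s) \<le> K * s ^ Suc k"
    proof (cases "s = 0")
      case False
      have "norm (z t s - z t 0) \<le> K * s ^ k * s - K * s ^ k * 0"
      proof (rule differentiable_bound_general[where \<phi>' = "\<lambda>_. K * s ^ k"])
        show "continuous_on {0..s} (z t)"
          by (rule continuous_on_subset[OF cont]) (use * in auto)
        fix \<sigma> assume \<sigma>: "0 < \<sigma>" "\<sigma> < s"
        then show "(z t has_vector_derivative z' t \<sigma>) (at \<sigma>)"
          using * by (intro deriv) auto
        have "norm (z' t \<sigma>) \<le> K * \<sigma> ^ k" using * \<sigma> by (intro K) auto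
        also have "\<dots> \<le> K * s ^ k" using \<sigma> K by (intro mult_left_mono power_mono) auto
        finally show "norm (z' t \<sigma>) \<le> K * s ^ k" .
        show "((*) (K * s ^ k) has_vector_derivative K * s ^ k) (at \<sigma>)"
          by (auto intro!: derivative_eq_intros simp flip: has_real_derivative_iff_has_vector_derivative)
      qed (use * False in \<open>auto intro!: continuous_intros\<close>)
      then show ?thesis by (simp add: z0 mult_ac)
    qed (simp add: z0)
  qed
qed

section \<open>Taylor remainders on convex sets\<close>

lemma onorm_blinfun_apply: "onorm (blinfun_apply X) = norm X"
  by (simp add: norm_blinfun.rep_eq)

lemma mean_value_bound:
  fixes f :: "'a::real_normed_vector \<Rightarrow> 'b::real_normed_vector" and f' :: "'a \<Rightarrow> 'a \<Rightarrow>\<^sub>L 'b"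
  assumes "convex U"
    and f: "\<And>v. v \<in> U \<Longrightarrow> (f has_derivative f' v) (at v)"
    and M: "\<And>v. v \<in> U \<Longrightarrow> norm (f' v) \<le> M"
    and "x \<in> U" "y \<in> U"
  shows "norm (f y - f x) \<le> M * norm (y - x)"
  by (rule differentiable_bound[OF \<open>convex U\<close> has_derivative_at_withinI[OF f]])
    (use assms in \<open>auto simp: onorm_blinfun_apply\<close>)

lemma taylor_remainder_1:
  fixes f :: "'a::real_normed_vector \<Rightarrow> 'b::real_normed_vector" and f' :: "'a \<Rightarrow> 'a \<Rightarrow>\<^sub>L 'b"
    and f'' :: "'a \<Rightarrow> 'a \<Rightarrow>\<^sub>L 'a \<Rightarrow>\<^sub>L 'b"
  assumes U: "convex U"
    and f: "\<And>v. v \<in> U \<Longrightarrow> (f has_derivative f' v) (at v)"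
    and f': "\<And>v. v \<in> U \<Longrightarrow> (f' has_derivative f'' v) (at v)"
    and M: "\<And>v. v \<in> U \<Longrightarrow> norm (f'' v) \<le> M"
    and xy: "x \<in> U" "y \<in> U"
  shows "norm (f y - f x - f' x (y - x)) \<le> M * norm (y - x) ^ 2"
proof -
  have sub: "closed_segment x y \<subseteq> U" using U xy by (simp add: closed_segment_subset)
  have M0: "0 \<le> M" using M[OF xy(1)] norm_ge_zero order_trans by blast
  have "norm (f y - f x - f' x (y - x)) \<le> norm (y - x) * (M * norm (y - x))"
  proof (rule differentiable_bound_linearization[where f' = "\<lambda>v. blinfun_apply (f' v)"])
    show "x + \<tau> *\<^sub>R (y - x) \<in> closed_segment x y" if "\<tau> \<in> {0..1}" for \<tau>
      using that by (auto simp: in_segment algebra_simps intro!: exI[of _ \<tau>])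
    fix v assume v: "v \<in> closed_segment x y"
    show "(f has_derivative blinfun_apply (f' v)) (at v within closed_segment x y)"
      using v sub f has_derivative_at_withinI by blast
    have "norm (f' v - f' x) \<le> M * norm (v - x)"
      using U f' M xy(1) subsetD[OF sub v] by (rule mean_value_bound)
    also have "\<dots> \<le> M * norm (y - x)"
      using M0 segment_bound1[OF v] by (intro mult_left_mono) auto
    finally show "onorm (blinfun_apply (f' v) - blinfun_apply (f' x)) \<le> M * norm (y - x)"
      by (simp add: norm_blinfun.rep_eq minus_blinfun.rep_eq fun_diff_def)
  qed simp
  then show ?thesis by (simp add: power2_eq_square mult_ac)
qed

text \<open>
  The factor \<open>1/6\<close> is lost, as the remainder is estimated by applying the mean value inequality
  to \<open>\<gamma>\<close>, whose derivative is a first-order remainder of \<open>f'\<close>.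
\<close>
lemma taylor_remainder_2:
  fixes f :: "'a::real_normed_vector \<Rightarrow> 'b::real_normed_vector" and f' :: "'a \<Rightarrow> 'a \<Rightarrow>\<^sub>L 'b"
    and f'' :: "'a \<Rightarrow> 'a \<Rightarrow>\<^sub>L 'a \<Rightarrow>\<^sub>L 'b" and f''' :: "'a \<Rightarrow> 'a \<Rightarrow>\<^sub>L 'a \<Rightarrow>\<^sub>L 'a \<Rightarrow>\<^sub>L 'b"
  assumes U: "convex U"
    and f: "\<And>v. v \<in> U \<Longrightarrow> (f has_derivative f' v) (at v)"
    and f': "\<And>v. v \<in> U \<Longrightarrow> (f' has_derivative f'' v) (at v)"
    and f'': "\<And>v. v \<in> U \<Longrightarrow> (f'' has_derivative f''' v) (at v)"
    and M: "\<And>v. v \<in> U \<Longrightarrow> norm (f''' v) \<le> M"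
    and xy: "x \<in> U" "y \<in> U"
  shows "norm (f y - f x - (f' x (y - x) + (1/2) *\<^sub>R f'' x (y - x) (y - x))) \<le> M * norm (y - x) ^ 3"
proof -
  define d where "d = y - x"
  have M0: "0 \<le> M" using M[OF xy(1)] norm_ge_zero order_trans by blast
  have inU: "x + \<tau> *\<^sub>R d \<in> U" if "\<tau> \<in> {0..1}" for \<tau>
  proof -
    have "x + \<tau> *\<^sub>R d \<in> closed_segment x y"
      using that by (auto simp: in_segment d_def algebra_simps intro!: exI[of _ \<tau>])
    then show ?thesis using U xy by (meson closed_segment_subset subsetD)
  qed
  define \<gamma> where "\<gamma> = (\<lambda>\<tau>. f (x + \<tau> *\<^sub>R d) - \<tau> *\<^sub>R f' x d - (\<tau>\<^sup>2/2) *\<^sub>R f'' x d d)"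
  have \<gamma>': "(\<gamma> has_vector_derivative f' (x + \<tau> *\<^sub>R d) d - f' x d - \<tau> *\<^sub>R f'' x d d) (at \<tau>)"
    if "\<tau> \<in> {0..1}" for \<tau>
  proof -
    have "((\<lambda>\<tau>. x + \<tau> *\<^sub>R d) has_derivative (\<lambda>c. c *\<^sub>R d)) (at \<tau>)"
      by (auto intro!: derivative_eq_intros)
    from has_derivative_compose[OF this f[OF inU[OF that]]]
    have "((\<lambda>\<tau>. f (x + \<tau> *\<^sub>R d)) has_vector_derivative f' (x + \<tau> *\<^sub>R d) d) (at \<tau>)"
      by (simp add: has_vector_derivative_def blinfun.scaleR_right)
    moreover have "((\<lambda>\<tau>. \<tau> *\<^sub>R f' x d) has_vector_derivative f' x d) (at \<tau>)"
      by (auto intro!: derivative_eq_intros)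
    moreover have "((\<lambda>\<tau>. (\<tau>\<^sup>2/2) *\<^sub>R f'' x d d) has_vector_derivative \<tau> *\<^sub>R f'' x d d) (at \<tau>)"
      by (auto intro!: derivative_eq_intros)
    ultimately show ?thesis unfolding \<gamma>_def by (intro has_vector_derivative_diff)
  qed
  have "norm (\<gamma> 1 - \<gamma> 0) \<le> M * norm d ^ 3 * 1 - M * norm d ^ 3 * 0"
  proof (rule differentiable_bound_general[where \<phi>' = "\<lambda>_. M * norm d ^ 3", OF zero_less_one])
    show "continuous_on {0..1} \<gamma>"
      using \<gamma>' by (meson continuous_at_imp_continuous_on has_vector_derivative_continuous)
    fix \<tau> :: real assume \<tau>: "0 < \<tau>" "\<tau> < 1"
    show "(\<gamma> has_vector_derivative f' (x + \<tau> *\<^sub>R d) d - f' x d - \<tau> *\<^sub>R f'' x d d) (at \<tau>)"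
      using \<gamma>' \<tau> by simp
    have "norm (f' (x + \<tau> *\<^sub>R d) - f' x - f'' x ((x + \<tau> *\<^sub>R d) - x)) \<le> M * norm ((x + \<tau> *\<^sub>R d) - x) ^ 2"
      by (rule taylor_remainder_1[OF U f' f'' M xy(1) inU]) (use \<tau> in auto)
    also have "\<dots> \<le> M * norm d ^ 2"
      using \<tau> M0 by (intro mult_left_mono power_mono) (auto simp: mult_left_le_one_le)
    finally have "norm (f' (x + \<tau> *\<^sub>R d) - f' x - \<tau> *\<^sub>R f'' x d) * norm d \<le> M * norm d ^ 2 * norm d"
      by (intro mult_right_mono) (auto simp: blinfun.scaleR_right)
    moreover have "norm ((f' (x + \<tau> *\<^sub>R d) - f' x - \<tau> *\<^sub>R f'' x d) d)
        \<le> norm (f' (x + \<tau> *\<^sub>R d) - f' x - \<tau> *\<^sub>R f'' x d) * norm d"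
      by (rule norm_blinfun)
    ultimately show "norm (f' (x + \<tau> *\<^sub>R d) d - f' x d - \<tau> *\<^sub>R f'' x d d) \<le> M * norm d ^ 3"
      by (simp add: blinfun.diff_left blinfun.scaleR_left power3_eq_cube power2_eq_square mult_ac)
    show "((*) (M * norm d ^ 3) has_vector_derivative M * norm d ^ 3) (at \<tau>)"
      by (auto intro!: derivative_eq_intros simp flip: has_real_derivative_iff_has_vector_derivative)
  qed (auto intro!: continuous_intros)
  then show ?thesis by (simp add: \<gamma>_def d_def algebra_simps)
qed

section \<open>Expansion of the exact solution\<close>

locale flow =
  fixes F :: "'a::banach \<Rightarrow> 'a" and u :: "real \<Rightarrow> 'a" and T r M :: real
    and J :: "'a \<Rightarrow> ('a \<Rightarrow>\<^sub>L 'a)"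
    and D2 :: "'a \<Rightarrow> ('a \<Rightarrow>\<^sub>L 'a \<Rightarrow>\<^sub>L 'a)"
    and D3 :: "'a \<Rightarrow> ('a \<Rightarrow>\<^sub>L 'a \<Rightarrow>\<^sub>L 'a \<Rightarrow>\<^sub>L 'a)"
    and D4 :: "'a \<Rightarrow> ('a \<Rightarrow>\<^sub>L 'a \<Rightarrow>\<^sub>L 'a \<Rightarrow>\<^sub>L 'a \<Rightarrow>\<^sub>L 'a)"
  assumes T_pos: "T > 0"
    and u_cont: "continuous_on {0..T} u"
    and u_ode: "\<And>t. t \<in> {0<..<T} \<Longrightarrow> (u has_vector_derivative F (u t)) (at t)"
    and r_pos: "r > 0"
    and F_deriv1: "\<And>v. v \<in> strip u T r \<Longrightarrow> (F has_derivative blinfun_apply (J v)) (at v)"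
    and F_deriv2: "\<And>v. v \<in> strip u T r \<Longrightarrow> (J has_derivative blinfun_apply (D2 v)) (at v)"
    and F_deriv3: "\<And>v. v \<in> strip u T r \<Longrightarrow> (D2 has_derivative blinfun_apply (D3 v)) (at v)"
    and F_deriv4: "\<And>v. v \<in> strip u T r \<Longrightarrow> (D3 has_derivative blinfun_apply (D4 v)) (at v)"
    and F_bounds: "\<And>v. v \<in> strip u T r \<Longrightarrow>
          norm (J v) \<le> M \<and> norm (D2 v) \<le> M \<and> norm (D3 v) \<le> M \<and> norm (D4 v) \<le> M"
begin

lemma ball_subset_strip: "0 \<le> t \<Longrightarrow> t \<le> T \<Longrightarrow> v \<in> ball (u t) r \<Longrightarrow> v \<in> strip u T r"
  by (auto simp: strip_def)

lemma u_in_strip: "0 \<le> t \<Longrightarrow> t \<le> T \<Longrightarrow> u t \<in> strip u T r"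
  using ball_subset_strip[of t "u t"] r_pos by simp

lemma u_shift_continuous: "0 \<le> t \<Longrightarrow> continuous_on {0..T - t} (\<lambda>s. u (t + s))"
  by (rule continuous_on_compose2[OF u_cont]) (auto intro!: continuous_intros)

lemma u_shift_derivative:
  assumes "0 \<le> t" "0 < s" "t + s < T"
  shows "((\<lambda>s. u (t + s)) has_vector_derivative F (u (t + s))) (at s)"
proof -
  have "((\<lambda>s. t + s) has_vector_derivative 1) (at s)"
    by (auto intro!: derivative_eq_intros)
  moreover have "(u has_vector_derivative F (u (t + s))) (at (t + s))"
    using assms by (intro u_ode) auto
  ultimately show ?thesis
    using vector_diff_chain_at[of "\<lambda>s. t + s" 1 s u] by (simp add: o_def)
qed

lemma F_u_continuous: "continuous_on {0..T} (\<lambda>t. F (u t))"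
proof (rule continuous_on_compose2[OF _ u_cont])
  show "continuous_on (strip u T r) F"
    using F_deriv1 has_derivative_continuous continuous_at_imp_continuous_on by blast
qed (use u_in_strip in auto)

lemma F_u_bounded:
  obtains L where "\<And>t. 0 \<le> t \<Longrightarrow> t \<le> T \<Longrightarrow> norm (F (u t)) \<le> L"
proof -
  have "bounded ((\<lambda>t. F (u t)) ` {0..T})"
    by (intro compact_imp_bounded compact_continuous_image F_u_continuous) simp
  then obtain L where "\<forall>x\<in>(\<lambda>t. F (u t)) ` {0..T}. norm x \<le> L" by (auto simp: bounded_iff)
  then show thesis by (intro that[of L]) simp
qed

lemma O_F: "unif_O T 0 (\<lambda>t s. F (u t))" and O_F_shift: "unif_O T 0 (\<lambda>t s. F (u (t + s)))"
proof -
  obtain L where L: "\<And>t. 0 \<le> t \<Longrightarrow> t \<le> T \<Longrightarrow> norm (F (u t)) \<le> L"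
    using that by (rule F_u_bounded)
  show "unif_O T 0 (\<lambda>t s. F (u t))" "unif_O T 0 (\<lambda>t s. F (u (t + s)))"
    by (auto intro!: unif_O_bounded[of T _ L] L)
qed

lemma O_J: "unif_O T 0 (\<lambda>t s. J (u t))" and O_D2: "unif_O T 0 (\<lambda>t s. D2 (u t))"
  and O_D3: "unif_O T 0 (\<lambda>t s. D3 (u t))"
  using F_bounds[OF u_in_strip] by (auto intro!: unif_O_bounded[of T _ M])

lemma O_JF: "unif_O T 0 (\<lambda>t s. J (u t) (F (u t)))"
  by (rule unif_O_apply[OF O_J O_F]) simp

text \<open>
  Transports a Taylor estimate on a ball of radius \<open>r\<close> around \<open>u t\<close> to the order calculus:
  for small \<open>s\<close> both perturbed points lie in that ball.
\<close>
lemma Taylor_remainder_uniform: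
  assumes e: "unif_O T 1 e" and d: "unif_O T 1 d" and p: "unif_O T k (\<lambda>t s. e t s - d t s)"
    and le: "\<And>t s. \<lbrakk>0 \<le> t; t \<le> T; convex (ball (u t) r); ball (u t) r \<subseteq> strip u T r;
        u t + d t s \<in> ball (u t) r; u t + e t s \<in> ball (u t) r\<rbrakk>
      \<Longrightarrow> norm (R t s) \<le> M * norm ((u t + e t s) - (u t + d t s)) ^ m"
    and n: "n \<le> k * m"
  shows "unif_O T n R"
proof -
  obtain h0 where h0: "h0 > 0"
    "\<And>t s. \<lbrakk>0 \<le> t; 0 \<le> s; t + s \<le> T; s \<le> h0\<rbrakk> \<Longrightarrow> norm (e t s) < r"
    using that by (rule unif_O_small[OF e zero_less_one r_pos])
  obtain h1 where h1: "h1 > 0"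
    "\<And>t s. \<lbrakk>0 \<le> t; 0 \<le> s; t + s \<le> T; s \<le> h1\<rbrakk> \<Longrightarrow> norm (d t s) < r"
    using that by (rule unif_O_small[OF d zero_less_one r_pos])
  show ?thesis
  proof (rule unif_O_dominated[OF p _ _ n])
    fix t s assume *: "0 \<le> t" "0 \<le> s" "t + s \<le> T" "s \<le> min h0 h1"
    have "norm (R t s) \<le> M * norm ((u t + e t s) - (u t + d t s)) ^ m"
      by (rule le) (use * h0 h1 ball_subset_strip[of t] in \<open>auto simp: dist_norm\<close>)
    then show "norm (R t s) \<le> M * norm (e t s - d t s) ^ m" by simp
  qed (use h0 h1 in auto)
qed

lemma F_perturb:
  assumes "unif_O T 1 e" "unif_O T 1 d" "unif_O T k (\<lambda>t s. e t s - d t s)" "n \<le> k * 2"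
  shows "unif_O T n (\<lambda>t s. F (u t + e t s) - F (u t + d t s)
           - J (u t + d t s) (e t s - d t s))"
proof (rule Taylor_remainder_uniform[OF assms(1-3) _ assms(4)])
  fix t s assume U: "convex (ball (u t) r)" "ball (u t) r \<subseteq> strip u T r"
    "u t + d t s \<in> ball (u t) r" "u t + e t s \<in> ball (u t) r"
  from taylor_remainder_1[OF U(1) F_deriv1[OF subsetD[OF U(2)]] F_deriv2[OF subsetD[OF U(2)]] _ U(3,4), of M]
      F_bounds[OF subsetD[OF U(2)]]
  show "norm (F (u t + e t s) - F (u t + d t s) - J (u t + d t s) (e t s - d t s))
     \<le> M * norm ((u t + e t s) - (u t + d t s)) ^ 2" by auto
qed

lemma F_increment:
  assumes "unif_O T 1 e"
  shows "unif_O T 1 (\<lambda>t s. F (u t + e t s) - F (u t))"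
proof -
  have "unif_O T 1 (\<lambda>t s. F (u t + e t s) - F (u t + 0))"
  proof (rule Taylor_remainder_uniform[OF assms unif_O_zero, of 1 _ 1])
    fix t s assume U: "convex (ball (u t) r)" "ball (u t) r \<subseteq> strip u T r"
      "u t + 0 \<in> ball (u t) r" "u t + e t s \<in> ball (u t) r"
    from mean_value_bound[OF U(1) F_deriv1[OF subsetD[OF U(2)]] _ U(3,4), of M]
      F_bounds[OF subsetD[OF U(2)]]
    show "norm (F (u t + e t s) - F (u t + 0)) \<le> M * norm ((u t + e t s) - (u t + 0)) ^ 1" by auto
  qed (use assms in auto)
  then show ?thesis by simp
qed

lemma J_increment:
  assumes "unif_O T 1 e"
  shows "unif_O T 1 (\<lambda>t s. J (u t + e t s) - J (u t))"
proof -
  have "unif_O T 1 (\<lambda>t s. J (u t + e t s) - J (u t + 0))"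
  proof (rule Taylor_remainder_uniform[OF assms unif_O_zero, of 1 _ 1])
    fix t s assume U: "convex (ball (u t) r)" "ball (u t) r \<subseteq> strip u T r"
      "u t + 0 \<in> ball (u t) r" "u t + e t s \<in> ball (u t) r"
    from mean_value_bound[OF U(1) F_deriv2[OF subsetD[OF U(2)]] _ U(3,4), of M]
      F_bounds[OF subsetD[OF U(2)]]
    show "norm (J (u t + e t s) - J (u t + 0)) \<le> M * norm ((u t + e t s) - (u t + 0)) ^ 1" by auto
  qed (use assms in auto)
  then show ?thesis by simp
qed

lemma J_expansion_1:
  assumes "unif_O T 1 e"
  shows "unif_O T 2 (\<lambda>t s. J (u t + e t s) - J (u t) - D2 (u t) (e t s))"
proof -
  have "unif_O T 2 (\<lambda>t s. J (u t + e t s) - J (u t + 0) - D2 (u t + 0) (e t s - 0))"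
  proof (rule Taylor_remainder_uniform[OF assms unif_O_zero, of 1 _ 2])
    fix t s assume U: "convex (ball (u t) r)" "ball (u t) r \<subseteq> strip u T r"
      "u t + 0 \<in> ball (u t) r" "u t + e t s \<in> ball (u t) r"
    from taylor_remainder_1[OF U(1) F_deriv2[OF subsetD[OF U(2)]] F_deriv3[OF subsetD[OF U(2)]] _ U(3,4), of M]
      F_bounds[OF subsetD[OF U(2)]]
    show "norm (J (u t + e t s) - J (u t + 0) - D2 (u t + 0) (e t s - 0))
      \<le> M * norm ((u t + e t s) - (u t + 0)) ^ 2" by auto
  qed (use assms in auto)
  then show ?thesis by simp
qed

lemma J_expansion_2:
  assumes "unif_O T 1 e"
  shows "unif_O T 3 (\<lambda>t s. J (u t + e t s) - J (u t)
           - (D2 (u t) (e t s) + (1/2) *\<^sub>R D3 (u t) (e t s) (e t s)))"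
proof (rule Taylor_remainder_uniform[OF assms unif_O_zero, of 1 _ 3])
  fix t s assume U: "convex (ball (u t) r)" "ball (u t) r \<subseteq> strip u T r"
    "u t + 0 \<in> ball (u t) r" "u t + e t s \<in> ball (u t) r"
  from taylor_remainder_2[OF U(1) F_deriv2[OF subsetD[OF U(2)]] F_deriv3[OF subsetD[OF U(2)]] F_deriv4[OF subsetD[OF U(2)]] _ U(3,4), of M]
      F_bounds[OF subsetD[OF U(2)]]
  show "norm (J (u t + e t s) - J (u t)
      - (D2 (u t) (e t s) + (1/2) *\<^sub>R D3 (u t) (e t s) (e t s)))
    \<le> M * norm ((u t + e t s) - (u t + 0)) ^ 3" by auto
qed (use assms in auto)

text \<open>
  Expansions of \<open>u\<close> and of \<open>F\<close> along \<open>u\<close> are obtained in turn: an expansion of \<open>F\<close> along \<open>u\<close> to order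
  \<open>k\<close> integrates to one of \<open>u\<close> to order \<open>k + 1\<close>, and Taylor's formula for \<open>F\<close> then improves the former.
\<close>
lemma u_expansion_0: "unif_O T 1 (\<lambda>t s. u (t + s) - u t)"
proof -
  have "unif_O T (Suc 0) (\<lambda>t s. u (t + s) - u t)"
    by (rule unif_O_integrate[OF O_F_shift])
      (auto intro!: continuous_intros derivative_eq_intros u_shift_continuous u_shift_derivative)
  then show ?thesis by simp
qed

lemma F_u_expansion_0: "unif_O T 1 (\<lambda>t s. F (u (t + s)) - F (u t))"
  using F_increment[OF u_expansion_0] by simp

lemma u_expansion_1: "unif_O T 2 (\<lambda>t s. u (t + s) - u t - s *\<^sub>R F (u t))"
proof -
  have "unif_O T (Suc 1) (\<lambda>t s. u (t + s) - u t - s *\<^sub>R F (u t))"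
    by (rule unif_O_integrate[OF F_u_expansion_0])
      (auto intro!: continuous_intros derivative_eq_intros u_shift_continuous u_shift_derivative)
  then show ?thesis by (simp add: numeral_2_eq_2)
qed

lemma F_u_expansion_1: "unif_O T 2 (\<lambda>t s. F (u (t + s)) - F (u t) - s *\<^sub>R J (u t) (F (u t)))"
proof -
  have "unif_O T 2 (\<lambda>t s. F (u t + (u (t + s) - u t)) - F (u t + 0)
      - J (u t + 0) ((u (t + s) - u t) - 0))"
    by (rule F_perturb[OF u_expansion_0 unif_O_zero, of 1]) (use u_expansion_0 in auto)
  moreover have "unif_O T 2 (\<lambda>t s. J (u t) (u (t + s) - u t - s *\<^sub>R F (u t)))"
    by (rule unif_O_apply[OF O_J u_expansion_1]) simp
  ultimately show ?thesis
    by (rule unif_O_cong[OF unif_O_add]) (simp add: blinfun.bilinear_simps)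
qed

lemma u_expansion_2:
  "unif_O T 3 (\<lambda>t s. u (t + s) - u t - s *\<^sub>R F (u t) - (s\<^sup>2/2) *\<^sub>R J (u t) (F (u t)))"
proof -
  have "unif_O T (Suc 2) (\<lambda>t s. u (t + s) - u t - s *\<^sub>R F (u t) - (s\<^sup>2/2) *\<^sub>R J (u t) (F (u t)))"
    by (rule unif_O_integrate[OF F_u_expansion_1])
      (auto intro!: continuous_intros derivative_eq_intros u_shift_continuous u_shift_derivative)
  then show ?thesis by (simp add: numeral_3_eq_3 numeral_2_eq_2)
qed

text \<open>The coefficient of \<open>s\<^sup>2\<close> in \<open>J (u (t + s))\<close>, that is, half the second time derivative.\<close>
definition J_coeff2 :: "real \<Rightarrow> 'a \<Rightarrow>\<^sub>L 'a" where
  "J_coeff2 t = (1/2) *\<^sub>R (D2 (u t) (J (u t) (F (u t))) + D3 (u t) (F (u t)) (F (u t)))"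

text \<open>
  \<open>g_deriv2\<close> and \<open>g_deriv3\<close> are the second and third derivative at \<open>s = 0\<close> of
  \<open>s \<mapsto> g (u (t + s))\<close>, where \<open>g\<close> is \<open>nonlin F J (u t)\<close>.
\<close>
definition g_deriv2 :: "real \<Rightarrow> 'a" where
  "g_deriv2 t = D2 (u t) (F (u t)) (F (u t))"

definition g_deriv3 :: "real \<Rightarrow> 'a" where
  "g_deriv3 t = 2 *\<^sub>R (D2 (u t) (F (u t)) (J (u t) (F (u t))) + J_coeff2 t (F (u t)))"

lemma O_J_coeff2: "unif_O T 0 (\<lambda>t s. J_coeff2 t)"
  unfolding J_coeff2_def
  by (intro unif_O_scaleR unif_O_add unif_O_apply[where k = 0 and l = 0] O_D2 O_D3 O_F O_JF) auto

lemma J_u_expansion_0: "unif_O T 1 (\<lambda>t s. J (u (t + s)) - J (u t))"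
  using J_increment[OF u_expansion_0] by simp

lemma J_u_expansion_1: "unif_O T 2 (\<lambda>t s. J (u (t + s)) - J (u t) - s *\<^sub>R D2 (u t) (F (u t)))"
proof -
  have "unif_O T 2 (\<lambda>t s. D2 (u t) (u (t + s) - u t - s *\<^sub>R F (u t)))"
    by (rule unif_O_apply[OF O_D2 u_expansion_1]) simp
  from unif_O_add[OF J_expansion_1[OF u_expansion_0] this]
  show ?thesis by (rule unif_O_cong) (simp add: blinfun.bilinear_simps)
qed

lemma J_u_expansion_2:
  "unif_O T 3 (\<lambda>t s. J (u (t + s)) - J (u t) - s *\<^sub>R D2 (u t) (F (u t)) - s\<^sup>2 *\<^sub>R J_coeff2 t)"
proof -
  define e where "e = (\<lambda>t s. u (t + s) - u t)"
  define e1 where "e1 = (\<lambda>t s. e t s - s *\<^sub>R F (u t))"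
  define e2 where "e2 = (\<lambda>t s. e t s - s *\<^sub>R F (u t) - (s\<^sup>2/2) *\<^sub>R J (u t) (F (u t)))"
  have e: "unif_O T 1 e" "unif_O T 2 e1" "unif_O T 3 e2"
    using u_expansion_0 u_expansion_1 u_expansion_2 by (simp_all add: e_def e1_def e2_def)
  have 1: "unif_O T 3 (\<lambda>t s. D2 (u t) (e2 t s))"
    by (rule unif_O_apply[OF O_D2 e(3)]) simp
  \<comment> \<open>The quadratic form \<open>D3 e e - D3 (s f) (s f)\<close> is telescoped as \<open>D3 e (e - s f) + D3 (e - s f) (s f)\<close>.\<close>
  have 2: "unif_O T 3 (\<lambda>t s. (1/2) *\<^sub>R D3 (u t) (e t s) (e1 t s))"
    by (intro unif_O_scaleR unif_O_apply[OF unif_O_apply[OF O_D3 e(1) order_refl] e(2)]) simp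
  have 3: "unif_O T 3 (\<lambda>t s. (1/2 * s ^ 1) *\<^sub>R D3 (u t) (e1 t s) (F (u t)))"
    by (intro unif_O_scaleR_power[OF unif_O_apply[OF unif_O_apply[OF O_D3 e(2) order_refl] O_F order_refl]]) simp
  show ?thesis
  proof (rule unif_O_cong[OF unif_O_add[OF J_expansion_2[OF e(1)] unif_O_add[OF 1 unif_O_add[OF 2 3]]]])
    fix t s
    have "J (u t + e t s) = J (u (t + s))" by (simp add: e_def)
    then show "J (u t + e t s) - J (u t) - (D2 (u t) (e t s) + (1/2) *\<^sub>R D3 (u t) (e t s) (e t s))
       + (D2 (u t) (e2 t s) + ((1/2) *\<^sub>R D3 (u t) (e t s) (e1 t s)
          + (1/2 * s ^ 1) *\<^sub>R D3 (u t) (e1 t s) (F (u t))))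
       = J (u (t + s)) - J (u t) - s *\<^sub>R D2 (u t) (F (u t)) - s\<^sup>2 *\<^sub>R J_coeff2 t"
      by (simp add: e1_def e2_def J_coeff2_def blinfun.bilinear_simps algebra_simps power2_eq_square)
  qed
qed

text \<open>
  The function expanded here is the time derivative of \<open>g\<close> along the solution. Its first factor is
  \<open>O(s)\<close>, so an expansion of the second factor with error \<open>O(s\<^sup>2)\<close> suffices.
\<close>
lemma g_rate_expansion:
  "unif_O T 3 (\<lambda>t s. (J (u (t + s)) - J (u t)) (F (u (t + s))) - s *\<^sub>R g_deriv2 t - (s\<^sup>2/2) *\<^sub>R g_deriv3 t)"
proof -
  define X where "X = (\<lambda>t s. J (u (t + s)) - J (u t))"
  define X2 where "X2 = (\<lambda>t s. X t s - s *\<^sub>R D2 (u t) (F (u t)) - s\<^sup>2 *\<^sub>R J_coeff2 t)"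
  define Y1 where "Y1 = (\<lambda>t s. F (u (t + s)) - F (u t) - s *\<^sub>R J (u t) (F (u t)))"
  have X: "unif_O T 1 X" and X2: "unif_O T 3 X2" and Y1: "unif_O T 2 Y1"
    using J_u_expansion_0 J_u_expansion_2 F_u_expansion_1 by (simp_all add: X_def X2_def Y1_def)
  \<comment> \<open>With \<open>p = X - X2\<close> and \<open>q = F (u (t + s)) - Y1\<close> the product is \<open>X Y1 + X2 q + p q\<close>, and \<open>p q\<close>
    differs from the claimed polynomial by its cubic term only, the last of the four below.\<close>
  have 1: "unif_O T 3 (\<lambda>t s. X t s (Y1 t s))"
    by (rule unif_O_apply[OF X Y1]) simp
  have 2: "unif_O T 3 (\<lambda>t s. X2 t s (F (u t)))"
    by (rule unif_O_apply[OF X2 O_F]) simp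
  have 3: "unif_O T 3 (\<lambda>t s. (1 * s ^ 1) *\<^sub>R X2 t s (J (u t) (F (u t))))"
    by (rule unif_O_scaleR_power[OF unif_O_apply[OF X2 O_JF order_refl]]) simp
  have 4: "unif_O T 3 (\<lambda>t s. (1 * s ^ 3) *\<^sub>R J_coeff2 t (J (u t) (F (u t))))"
    by (rule unif_O_scaleR_power[OF unif_O_apply[OF O_J_coeff2 O_JF order_refl]]) simp
  show ?thesis
  proof (rule unif_O_cong[OF unif_O_add[OF 1 unif_O_add[OF 2 unif_O_add[OF 3 4]]]])
    fix t s
    have X: "X t s = X2 t s + s *\<^sub>R D2 (u t) (F (u t)) + s\<^sup>2 *\<^sub>R J_coeff2 t"
      by (simp add: X2_def)
    have Y: "F (u (t + s)) = Y1 t s + F (u t) + s *\<^sub>R J (u t) (F (u t))"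
      by (simp add: Y1_def)
    show "X t s (Y1 t s) + (X2 t s (F (u t)) + ((1 * s ^ 1) *\<^sub>R X2 t s (J (u t) (F (u t)))
        + (1 * s ^ 3) *\<^sub>R J_coeff2 t (J (u t) (F (u t)))))
      = (J (u (t + s)) - J (u t)) (F (u (t + s))) - s *\<^sub>R g_deriv2 t - (s\<^sup>2/2) *\<^sub>R g_deriv3 t"
      unfolding X_def[symmetric, THEN fun_cong, THEN fun_cong, simplified] X Y g_deriv2_def g_deriv3_def
      by (simp add: blinfun.bilinear_simps algebra_simps power2_eq_square power3_eq_cube)
  qed
qed

lemma g_expansion:
  "unif_O T 4 (\<lambda>t s. nonlin F J (u t) (u (t + s)) - nonlin F J (u t) (u t)
     - (s\<^sup>2/2) *\<^sub>R g_deriv2 t - (s ^ 3/6) *\<^sub>R g_deriv3 t)"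
proof -
  have "unif_O T (Suc 3) (\<lambda>t s. nonlin F J (u t) (u (t + s)) - nonlin F J (u t) (u t)
     - (s\<^sup>2/2) *\<^sub>R g_deriv2 t - (s ^ 3/6) *\<^sub>R g_deriv3 t)"
  proof (rule unif_O_integrate[OF g_rate_expansion])
    fix t s :: real assume t: "0 \<le> t"
    have "continuous_on {0..T - t} (\<lambda>s. F (u (t + s)))"
      by (rule continuous_on_compose2[OF F_u_continuous]) (use t in \<open>auto intro!: continuous_intros\<close>)
    then show "continuous_on {0..T - t} (\<lambda>s. nonlin F J (u t) (u (t + s)) - nonlin F J (u t) (u t)
       - (s\<^sup>2/2) *\<^sub>R g_deriv2 t - (s ^ 3/6) *\<^sub>R g_deriv3 t)"
      unfolding nonlin_def using u_shift_continuous[OF t] by (auto intro!: continuous_intros)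
    assume s: "0 < s" "t + s < T"
    have u: "((\<lambda>s. u (t + s)) has_vector_derivative F (u (t + s))) (at s)"
      using t s by (rule u_shift_derivative)
    have "(F has_derivative J (u (t + s))) (at (u (t + s)))"
      using t s by (intro F_deriv1 u_in_strip) auto
    from has_derivative_compose[OF u[unfolded has_vector_derivative_def] this]
    have "((\<lambda>s. F (u (t + s))) has_vector_derivative J (u (t + s)) (F (u (t + s)))) (at s)"
      by (simp add: has_vector_derivative_def blinfun.scaleR_right)
    moreover have "((\<lambda>s. J (u t) (u (t + s))) has_vector_derivative J (u t) (F (u (t + s)))) (at s)"
      by (rule bounded_linear.has_vector_derivative[OF blinfun.bounded_linear_right u])
    ultimately have g: "((\<lambda>s. nonlin F J (u t) (u (t + s))) has_vector_derivative
        (J (u (t + s)) - J (u t)) (F (u (t + s)))) (at s)"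
      unfolding nonlin_def blinfun.diff_left by (rule has_vector_derivative_diff)
    have p: "((\<lambda>s. (s\<^sup>2/2) *\<^sub>R g_deriv2 t) has_vector_derivative s *\<^sub>R g_deriv2 t) (at s)"
      "((\<lambda>s. (s ^ 3/6) *\<^sub>R g_deriv3 t) has_vector_derivative (s\<^sup>2/2) *\<^sub>R g_deriv3 t) (at s)"
      by (auto intro!: derivative_eq_intros simp: power2_eq_square)
    show "((\<lambda>s. nonlin F J (u t) (u (t + s)) - nonlin F J (u t) (u t)
       - (s\<^sup>2/2) *\<^sub>R g_deriv2 t - (s ^ 3/6) *\<^sub>R g_deriv3 t) has_vector_derivative
       (J (u (t + s)) - J (u t)) (F (u (t + s))) - s *\<^sub>R g_deriv2 t - (s\<^sup>2/2) *\<^sub>R g_deriv3 t) (at s)"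
      using has_vector_derivative_diff[OF has_vector_derivative_diff[OF has_vector_derivative_diff[OF g
          has_vector_derivative_const] p(1)] p(2)] by simp
  qed simp
  then show ?thesis by (simp add: eval_nat_numeral)
qed

end

section \<open>The stages of the method\<close>

locale dpg_flow = flow +
  fixes S :: "'a \<Rightarrow> real \<Rightarrow> 'a \<Rightarrow>\<^sub>L 'a" and B :: real
  assumes semigroup: "\<And>v. v \<in> strip u T r \<Longrightarrow> generates (J v) (S v)"
    and semigroup_bound: "\<And>v h. v \<in> strip u T r \<Longrightarrow> 0 \<le> h \<Longrightarrow> h \<le> T \<Longrightarrow> norm (S v h) \<le> B"
begin

lemma semigroup_along_solution: "0 \<le> t \<Longrightarrow> t \<le> T \<Longrightarrow> bounded_generator (J (u t)) (S (u t)) T B"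
  using semigroup[OF u_in_strip] semigroup_bound[OF u_in_strip] T_pos
  by unfold_locales auto

lemma O_phi: "p \<noteq> 0 \<Longrightarrow> unif_O T 0 (\<lambda>t h. phi p (S (u t)) h)"
  by (rule unif_O_bounded[of T _ B]) (auto intro!: bounded_generator.phi_bound[OF semigroup_along_solution])

lemma phi_2_uniform:
  "unif_O T 2 (\<lambda>t h. phi 2 (S (u t)) h - (1/2) *\<^sub>R id_blinfun - (h/6) *\<^sub>R J (u t))"
proof (rule unif_OI[OF zero_less_one])
  fix t h :: real assume *: "0 \<le> t" "0 \<le> h" "t + h \<le> T" "h \<le> 1"
  interpret bounded_generator "J (u t)" "S (u t)" T B using * by (intro semigroup_along_solution) auto
  have "norm (phi 2 (S (u t)) h - (1/2) *\<^sub>R id_blinfun - (h/6) *\<^sub>R J (u t))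
      \<le> B * (norm (J (u t)))\<^sup>2 * h\<^sup>2"
    using * by (intro phi_2_expansion) auto
  also have "\<dots> \<le> B * M\<^sup>2 * h\<^sup>2"
    using * F_bounds[OF u_in_strip, of t] B_nonneg by (intro mult_right_mono mult_left_mono power_mono) auto
  finally show "norm (phi 2 (S (u t)) h - (1/2) *\<^sub>R id_blinfun - (h/6) *\<^sub>R J (u t)) \<le> B * M\<^sup>2 * h\<^sup>2" .
qed

lemma stage2_expansion_2:
  "unif_O T 3 (\<lambda>t h. stage2 F J S h (u t) - u t - (h/2) *\<^sub>R F (u t) - (h\<^sup>2/6) *\<^sub>R J (u t) (F (u t)))"
proof -
  have "unif_O T 3 (\<lambda>t h. (1 * h ^ 1) *\<^sub>R
      (phi 2 (S (u t)) h - (1/2) *\<^sub>R id_blinfun - (h/6) *\<^sub>R J (u t)) (F (u t)))"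
    by (rule unif_O_scaleR_power[OF unif_O_apply[OF phi_2_uniform O_F order_refl]]) simp
  then show ?thesis
    by (rule unif_O_cong)
      (simp add: stage2_def nonlin_def blinfun.bilinear_simps algebra_simps power2_eq_square)
qed

lemma stage2_expansion_1:
  "unif_O T 2 (\<lambda>t h. stage2 F J S h (u t) - u t - (h/2) *\<^sub>R F (u t))"
proof -
  have lower: "unif_O T 2 (\<lambda>t h. (1/6 * h ^ 2) *\<^sub>R J (u t) (F (u t)))"
    by (rule unif_O_scaleR_power[OF O_JF]) simp
  show ?thesis
    by (rule unif_O_cong[OF unif_O_add[OF unif_O_mono[OF stage2_expansion_2] lower]]) simp_all
qed

lemma stage2_expansion_0: "unif_O T 1 (\<lambda>t h. stage2 F J S h (u t) - u t)"
proof -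
  have lower: "unif_O T 1 (\<lambda>t h. (1/2 * h ^ 1) *\<^sub>R F (u t))"
    by (rule unif_O_scaleR_power[OF O_F]) simp
  show ?thesis
    by (rule unif_O_cong[OF unif_O_add[OF unif_O_mono[OF stage2_expansion_1] lower]]) simp_all
qed

lemma stage3_expansion_2:
  "unif_O T 3 (\<lambda>t h. stage3 F J S h (u t) - u t - h *\<^sub>R F (u t) - (h\<^sup>2/2) *\<^sub>R J (u t) (F (u t)))"
proof -
  have "unif_O T 3 (\<lambda>t h. (1 * h ^ 1) *\<^sub>R
      J (u t) (stage2 F J S h (u t) - u t - (h/2) *\<^sub>R F (u t)))"
    by (rule unif_O_scaleR_power[OF unif_O_apply[OF O_J stage2_expansion_1 order_refl]]) simp
  then show ?thesis
    by (rule unif_O_cong)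
      (simp add: stage3_def nonlin_def blinfun.bilinear_simps algebra_simps power2_eq_square)
qed

text \<open>Both expansions have the terms \<open>h f + h\<^sup>2/2 A f\<close>.\<close>
lemma stage3_defect: "unif_O T 3 (\<lambda>t h. stage3 F J S h (u t) - u (t + h))"
  by (rule unif_O_cong[OF unif_O_diff[OF stage3_expansion_2 u_expansion_2]]) simp

lemma stage3_expansion_0: "unif_O T 1 (\<lambda>t h. stage3 F J S h (u t) - u t)"
  using unif_O_add[OF unif_O_mono[OF stage3_defect, of 1] u_expansion_0] by simp

text \<open>The constant is \<open>1/24 = 1/6 - 1/8\<close>: the stage has \<open>h\<^sup>2/6\<close> where \<open>u (t + h/2)\<close> has \<open>h\<^sup>2/8\<close>.\<close>
lemma stage2_defect_2:
  "unif_O T 3 (\<lambda>t h. stage2 F J S h (u t) - u (t + h/2) - (h\<^sup>2/24) *\<^sub>R J (u t) (F (u t)))"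
  by (rule unif_O_cong[OF unif_O_diff[OF stage2_expansion_2 unif_O_half[OF u_expansion_2]]])
    (simp add: power_divide algebra_simps flip: scaleR_add_left)

lemma stage2_defect: "unif_O T 2 (\<lambda>t h. stage2 F J S h (u t) - u (t + h/2))"
proof -
  have lower: "unif_O T 2 (\<lambda>t h. (1/24 * h ^ 2) *\<^sub>R J (u t) (F (u t)))"
    by (rule unif_O_scaleR_power[OF O_JF]) simp
  show ?thesis
    by (rule unif_O_cong[OF unif_O_add[OF unif_O_mono[OF stage2_defect_2] lower]]) simp_all
qed

lemma g_perturb:
  assumes "unif_O T 1 e" "unif_O T 1 d" "unif_O T k (\<lambda>t h. e t h - d t h)" "n \<le> k * 2"
  shows "unif_O T n (\<lambda>t h. nonlin F J (u t) (u t + e t h) - nonlin F J (u t) (u t + d t h)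
           - (J (u t + d t h) - J (u t)) (e t h - d t h))"
  by (rule unif_O_cong[OF F_perturb[OF assms]]) (simp add: nonlin_def blinfun.bilinear_simps)

text \<open>
  Taylor expansion is done at \<open>u (t + h/2)\<close>, where the derivative of \<open>g\<close> is \<open>h/2 D2 w f + O(h\<^sup>2)\<close>, and
  not at \<open>w\<close>. The two vectors then enter \<open>D2 w\<close> in the same order as in the correction factor, so that
  the terms of order \<open>h\<^sup>3\<close> cancel literally.
\<close>
lemma g_stage2:
  "unif_O T 4 (\<lambda>t h. nonlin F J (u t) (stage2 F J S h (u t)) - nonlin F J (u t) (u (t + h/2))
     - (h ^ 3/48) *\<^sub>R D2 (u t) (F (u t)) (J (u t) (F (u t))))"
proof -
  define X where "X = (\<lambda>t h. J (u (t + h/2)) - J (u t))"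
  define X1 where "X1 = (\<lambda>t h. X t h - (h/2) *\<^sub>R D2 (u t) (F (u t)))"
  define d where "d = (\<lambda>t h. stage2 F J S h (u t) - u (t + h/2))"
  define d2 where "d2 = (\<lambda>t h. d t h - (h\<^sup>2/24) *\<^sub>R J (u t) (F (u t)))"
  have X: "unif_O T 1 X" "unif_O T 2 X1"
    using unif_O_half[OF J_u_expansion_0] unif_O_half[OF J_u_expansion_1] by (simp_all add: X_def X1_def)
  have d: "unif_O T 3 d2" using stage2_defect_2 by (simp add: d2_def d_def)
  have 1: "unif_O T 4 (\<lambda>t h. nonlin F J (u t) (stage2 F J S h (u t)) - nonlin F J (u t) (u (t + h/2))
      - X t h (d t h))"
    using g_perturb[OF stage2_expansion_0 unif_O_half[OF u_expansion_0], of 2 4] stage2_defect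
    by (simp add: X_def d_def)
  have 2: "unif_O T 4 (\<lambda>t h. X t h (d2 t h))"
    by (rule unif_O_apply[OF X(1) d]) simp
  have 3: "unif_O T 4 (\<lambda>t h. (1/24 * h ^ 2) *\<^sub>R X1 t h (J (u t) (F (u t))))"
    by (rule unif_O_scaleR_power[OF unif_O_apply[OF X(2) O_JF order_refl]]) simp
  show ?thesis
    by (rule unif_O_cong[OF unif_O_add[OF 1 unif_O_add[OF 2 3]]])
      (simp add: X1_def d2_def blinfun.bilinear_simps algebra_simps power2_eq_square power3_eq_cube)
qed

text \<open>
  The second difference of the stages is \<open>(1/2 - 2/6) h\<^sup>2 A f = h\<^sup>2/6 A f\<close> to leading order, and
  \<open>1/4 \<cdot> 1/2 \<cdot> 1/6 = 1/48\<close>.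
\<close>
lemma correction_expansion:
  "unif_O T 4 (\<lambda>t h. correction F J S h (u t)
     + (h ^ 3/48) *\<^sub>R D2 (u t) (F (u t)) (J (u t) (F (u t))))"
proof -
  define X where "X = (\<lambda>t h. nonlin_deriv J (u t) (stage2 F J S h (u t)))"
  define X1 where "X1 = (\<lambda>t h. X t h - (h/2) *\<^sub>R D2 (u t) (F (u t)))"
  define d where "d = (\<lambda>t h. stage3 F J S h (u t) - 2 *\<^sub>R stage2 F J S h (u t) + u t)"
  define d2 where "d2 = (\<lambda>t h. d t h - (h\<^sup>2/6) *\<^sub>R J (u t) (F (u t)))"
  have X: "unif_O T 1 X"
    using J_increment[OF stage2_expansion_0] by (simp add: X_def nonlin_deriv_def)
  have "unif_O T 2 (\<lambda>t h. D2 (u t) (stage2 F J S h (u t) - u t - (h/2) *\<^sub>R F (u t)))"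
    by (rule unif_O_apply[OF O_D2 stage2_expansion_1]) simp
  from unif_O_add[OF J_expansion_1[OF stage2_expansion_0] this]
  have X1: "unif_O T 2 X1"
    by (rule unif_O_cong) (simp add: X1_def X_def nonlin_deriv_def blinfun.bilinear_simps)
  have d2: "unif_O T 3 d2"
    by (rule unif_O_cong[OF unif_O_diff[OF stage3_expansion_2 unif_O_scaleR[OF stage2_expansion_2, of 2]]])
      (simp add: d2_def d_def scaleR_2 algebra_simps flip: scaleR_add_left)
  have 1: "unif_O T 4 (\<lambda>t h. X t h (d2 t h))"
    by (rule unif_O_apply[OF X d2]) simp
  have 2: "unif_O T 4 (\<lambda>t h. (1/6 * h ^ 2) *\<^sub>R X1 t h (J (u t) (F (u t))))"
    by (rule unif_O_scaleR_power[OF unif_O_apply[OF X1 O_JF order_refl]]) simp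
  show ?thesis
  proof (rule unif_O_cong[OF unif_O_scaleR[OF unif_O_add[OF 1 2], of "- 1/4"]])
    fix t h
    have "correction F J S h (u t) = (- 1/4) *\<^sub>R X t h (d t h)"
      by (simp add: correction_def X_def d_def)
    then show "(- 1/4) *\<^sub>R (X t h (d2 t h) + (1/6 * h ^ 2) *\<^sub>R X1 t h (J (u t) (F (u t))))
      = correction F J S h (u t) + (h ^ 3/48) *\<^sub>R D2 (u t) (F (u t)) (J (u t) (F (u t)))"
      by (simp add: X1_def d2_def blinfun.bilinear_simps algebra_simps power2_eq_square power3_eq_cube)
  qed
qed

lemma g_stage2_corrected_expansion:
  "unif_O T 4 (\<lambda>t h. nonlin F J (u t) (stage2 F J S h (u t)) + correction F J S h (u t)
     - nonlin F J (u t) (u t) - (h\<^sup>2/8) *\<^sub>R g_deriv2 t - (h ^ 3/48) *\<^sub>R g_deriv3 t)"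
  by (rule unif_O_cong[OF unif_O_add[OF unif_O_add[OF g_stage2 correction_expansion] unif_O_half[OF g_expansion]]])
    (simp add: power_divide)

lemma g_stage3_expansion:
  "unif_O T 4 (\<lambda>t h. nonlin F J (u t) (stage3 F J S h (u t))
     - nonlin F J (u t) (u t) - (h\<^sup>2/2) *\<^sub>R g_deriv2 t - (h ^ 3/6) *\<^sub>R g_deriv3 t)"
proof -
  have 1: "unif_O T 4 (\<lambda>t h. nonlin F J (u t) (stage3 F J S h (u t)) - nonlin F J (u t) (u (t + h))
      - (J (u (t + h)) - J (u t)) (stage3 F J S h (u t) - u (t + h)))"
    using g_perturb[OF stage3_expansion_0 u_expansion_0, of 3 4] stage3_defect by simp
  have 2: "unif_O T 4 (\<lambda>t h. (J (u (t + h)) - J (u t)) (stage3 F J S h (u t) - u (t + h)))"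
    by (rule unif_O_apply[OF J_u_expansion_0 stage3_defect]) simp
  show ?thesis
    by (rule unif_O_cong[OF unif_O_add[OF unif_O_add[OF 1 2] g_expansion]]) simp
qed

section \<open>Variation of constants and the local error\<close>

text \<open>
  Variation of constants, with \<open>g\<close> replaced by its expansion \<open>R\<close>. The function \<open>\<psi>\<close> interpolates between
  \<open>E h w\<close> at \<open>\<theta> = 0\<close> and \<open>u (t + h) - h \<integral> E ((1 - \<eta>) h) (R \<eta>) d\<eta>\<close> at \<open>\<theta> = 1\<close>; its derivative
  \<open>h E ((1 - \<theta>) h) (g (u (t + \<theta> h)) - R \<theta>)\<close> is \<open>O(h\<^sup>5)\<close>, and the integral over \<open>[0, 1]\<close> is the
  announced combination of \<open>\<phi>\<close>-functions.
\<close>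
lemma exact_solution_expansion:
  "unif_O T 5 (\<lambda>t h. u (t + h) - (S (u t) h (u t) + h *\<^sub>R phi 1 (S (u t)) h (nonlin F J (u t) (u t))
     + h ^ 3 *\<^sub>R phi 3 (S (u t)) h (g_deriv2 t) + h ^ 4 *\<^sub>R phi 4 (S (u t)) h (g_deriv3 t)))"
proof -
  obtain K h0 where K: "0 \<le> K" "0 < h0" "h0 \<le> 1"
    "\<And>t s. \<lbrakk>0 \<le> t; 0 \<le> s; t + s \<le> T; s \<le> h0\<rbrakk> \<Longrightarrow>
       norm (nonlin F J (u t) (u (t + s)) - nonlin F J (u t) (u t)
         - (s\<^sup>2/2) *\<^sub>R g_deriv2 t - (s ^ 3/6) *\<^sub>R g_deriv3 t) \<le> K * s ^ 4"
    using that by (rule unif_OE[OF g_expansion])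
  show ?thesis
  proof (rule unif_OI[OF K(2)])
    fix t h :: real assume th: "0 \<le> t" "0 \<le> h" "t + h \<le> T" "h \<le> h0"
    interpret bounded_generator "J (u t)" "S (u t)" T B using th by (intro semigroup_along_solution) auto
    define E where "E = (\<lambda>\<theta>. S (u t) ((1 - \<theta>) * h))"
    define R where "R = (\<lambda>\<theta>. nonlin F J (u t) (u t) + ((\<theta> * h)\<^sup>2/2) *\<^sub>R g_deriv2 t + ((\<theta> * h) ^ 3/6) *\<^sub>R g_deriv3 t)"
    define \<psi> where "\<psi> = (\<lambda>\<theta>. E \<theta> (u (t + \<theta> * h)) - h *\<^sub>R integral {0..\<theta>} (\<lambda>\<eta>. E \<eta> (R \<eta>)))"
    define \<psi>' where "\<psi>' = (\<lambda>\<theta>. h *\<^sub>R E \<theta> (nonlin F J (u t) (u (t + \<theta> * h)) - R \<theta>))"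
    have hT: "h \<le> T" using th by simp
    have Econt: "continuous_on {0..1} E"
      unfolding E_def by (rule reversed_continuous[OF th(2) hT])
    have Rcont: "continuous_on {0..1} (\<lambda>\<eta>. E \<eta> (R \<eta>))"
      unfolding R_def by (intro continuous_intros Econt) auto
    have le: "\<theta> * h \<le> h" if "\<theta> \<in> {0..1}" for \<theta>
      using that th by (intro mult_left_le_one_le) auto
    have "norm (\<psi> 1 - \<psi> 0) \<le> B * K * h ^ 5 * 1 - B * K * h ^ 5 * 0"
    proof (rule differentiable_bound_general[where f' = \<psi>' and \<phi>' = "\<lambda>_. B * K * h ^ 5", OF zero_less_one])
      have "continuous_on {0..1} (\<lambda>\<theta>. u (t + \<theta> * h))"
      proof (rule continuous_on_compose2[OF u_cont])
        show "(\<lambda>\<theta>. t + \<theta> * h) ` {0..1} \<subseteq> {0..T}"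
          using th le by fastforce
      qed (intro continuous_intros)
      then show "continuous_on {0..1} \<psi>"
        unfolding \<psi>_def
        by (intro continuous_intros Econt indefinite_integral_continuous_1 integrable_continuous_real Rcont)
      fix \<theta> :: real assume \<theta>: "0 < \<theta>" "\<theta> < 1"
      show "(\<psi> has_vector_derivative \<psi>' \<theta>) (at \<theta>)"
      \<comment> \<open>For \<open>h = 0\<close> the point \<open>t\<close> may be an end point, where \<open>u\<close> need not be differentiable.\<close>
      proof (cases "h = 0")
        case True
        then have "\<psi> = (\<lambda>_. u t)" "\<psi>' = (\<lambda>_. 0)" by (auto simp: \<psi>_def \<psi>'_def E_def)
        then show ?thesis by simp
      next
        case False
        then have h: "0 < h" using th by simp
        have lt: "\<theta> * h < h" using \<theta> h by simp
        have "((\<lambda>\<theta>. u (t + \<theta> * h)) has_vector_derivative h *\<^sub>R F (u (t + \<theta> * h))) (at \<theta>)"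
        proof -
          have "((\<lambda>\<theta>. \<theta> * h) has_vector_derivative h) (at \<theta>)"
            by (auto intro!: derivative_eq_intros)
          from vector_diff_chain_at[OF this u_shift_derivative[of t "\<theta> * h"]] show ?thesis
            using th \<theta> h lt by (simp add: o_def)
        qed
        moreover have "(E has_vector_derivative - (h *\<^sub>R (E \<theta> o\<^sub>L J (u t)))) (at \<theta>)"
        proof -
          have "((\<lambda>\<theta>. (1 - \<theta>) * h) has_vector_derivative - h) (at \<theta>)"
            by (auto intro!: derivative_eq_intros)
          moreover have "(1 - \<theta>) * h \<in> {0<..<T}"
            using hT lt mult_pos_pos[OF \<theta>(1) h] by (auto simp: left_diff_distrib)
          then have "(S (u t) has_vector_derivative (E \<theta> o\<^sub>L J (u t))) (at ((1 - \<theta>) * h))"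
            using E_derivative[of "(1 - \<theta>) * h"] at_within_Icc_at[of 0 "(1 - \<theta>) * h" T]
            by (simp add: E_def)
          ultimately show ?thesis
            using vector_diff_chain_at by (fastforce simp: E_def o_def)
        qed
        ultimately have "((\<lambda>\<theta>. E \<theta> (u (t + \<theta> * h))) has_vector_derivative
            E \<theta> (h *\<^sub>R F (u (t + \<theta> * h))) + (- (h *\<^sub>R (E \<theta> o\<^sub>L J (u t)))) (u (t + \<theta> * h))) (at \<theta>)"
          by (intro bounded_bilinear.has_vector_derivative[OF bounded_bilinear_blinfun_apply])
        moreover have "((\<lambda>\<theta>. integral {0..\<theta>} (\<lambda>\<eta>. E \<eta> (R \<eta>))) has_vector_derivative E \<theta> (R \<theta>)) (at \<theta>)"
          using integral_has_vector_derivative[OF Rcont, of \<theta>] \<theta> at_within_Icc_at[of 0 \<theta> 1] by simp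
        then have "((\<lambda>\<theta>. h *\<^sub>R integral {0..\<theta>} (\<lambda>\<eta>. E \<eta> (R \<eta>))) has_vector_derivative h *\<^sub>R E \<theta> (R \<theta>)) (at \<theta>)"
          by (rule bounded_linear.has_vector_derivative[OF bounded_linear_scaleR_right])
        ultimately show ?thesis
          unfolding \<psi>_def
          by (rule has_vector_derivative_eq_rhs[OF has_vector_derivative_diff])
            (simp add: \<psi>'_def nonlin_def blinfun.bilinear_simps algebra_simps)
      qed
      have "norm (nonlin F J (u t) (u (t + \<theta> * h)) - R \<theta>) \<le> K * (\<theta> * h) ^ 4"
        using K(4)[of t "\<theta> * h"] th \<theta> le[of \<theta>] by (simp add: R_def diff_diff_eq)
      also have "\<dots> \<le> K * h ^ 4"
        using th \<theta> le[of \<theta>] K by (intro mult_left_mono power_mono) auto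
      finally have "norm (E \<theta> (nonlin F J (u t) (u (t + \<theta> * h)) - R \<theta>)) \<le> B * (K * h ^ 4)"
        unfolding E_def using reversed_time_le[of h \<theta>] th \<theta> B_nonneg
        by (intro order_trans[OF E_apply_bound] mult_left_mono) auto
      from mult_left_mono[OF this th(2)] show "norm (\<psi>' \<theta>) \<le> B * K * h ^ 5"
        using th by (simp add: \<psi>'_def eval_nat_numeral mult_ac)
      show "((*) (B * K * h ^ 5) has_vector_derivative B * K * h ^ 5) (at \<theta>)"
        by (auto intro!: derivative_eq_intros simp flip: has_real_derivative_iff_has_vector_derivative)
    qed (auto intro!: continuous_intros)
    moreover have "\<psi> 0 = S (u t) h (u t)"
      by (simp add: \<psi>_def E_def)
    moreover have "((\<lambda>\<eta>. E \<eta> (R \<eta>)) has_integral phi 1 (S (u t)) h (nonlin F J (u t) (u t))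
        + h\<^sup>2 *\<^sub>R phi 3 (S (u t)) h (g_deriv2 t) + h ^ 3 *\<^sub>R phi 4 (S (u t)) h (g_deriv3 t)) {0..1}"
    proof (rule has_integral_eq)
      show "((\<lambda>\<theta>. (\<theta> ^ (1 - 1) / fact (1 - 1)) *\<^sub>R S (u t) ((1 - \<theta>) * h) (nonlin F J (u t) (u t))
          + h\<^sup>2 *\<^sub>R ((\<theta> ^ (3 - 1) / fact (3 - 1)) *\<^sub>R S (u t) ((1 - \<theta>) * h) (g_deriv2 t))
          + h ^ 3 *\<^sub>R ((\<theta> ^ (4 - 1) / fact (4 - 1)) *\<^sub>R S (u t) ((1 - \<theta>) * h) (g_deriv3 t))) has_integral
          phi 1 (S (u t)) h (nonlin F J (u t) (u t))
        + h\<^sup>2 *\<^sub>R phi 3 (S (u t)) h (g_deriv2 t) + h ^ 3 *\<^sub>R phi 4 (S (u t)) h (g_deriv3 t)) {0..1}"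
        by (intro has_integral_add has_integral_cmul phi_apply_has_integral th hT) auto
    qed (simp add: E_def R_def blinfun.bilinear_simps power_mult_distrib fact_numeral mult_ac)
    then have "\<psi> 1 = u (t + h) - h *\<^sub>R (phi 1 (S (u t)) h (nonlin F J (u t) (u t))
        + h\<^sup>2 *\<^sub>R phi 3 (S (u t)) h (g_deriv2 t) + h ^ 3 *\<^sub>R phi 4 (S (u t)) h (g_deriv3 t))"
      by (simp add: \<psi>_def E_def integral_unique)
    ultimately show "norm (u (t + h) - (S (u t) h (u t) + h *\<^sub>R phi 1 (S (u t)) h (nonlin F J (u t) (u t))
     + h ^ 3 *\<^sub>R phi 3 (S (u t)) h (g_deriv2 t) + h ^ 4 *\<^sub>R phi 4 (S (u t)) h (g_deriv3 t))) \<le> B * K * h ^ 5"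
      by (simp add: algebra_simps eval_nat_numeral)
  qed
qed

text \<open>
  The order conditions determine \<open>b2 = 16 \<phi>\<^sub>3 - 48 \<phi>\<^sub>4\<close> and \<open>b3 = 12 \<phi>\<^sub>4 - 2 \<phi>\<^sub>3\<close>. So these operators are
  uniformly bounded, and the errors of the stages enter the step with an additional factor \<open>h\<close>.
  Inserting the expansions, the coefficients of \<open>g_deriv2\<close> and \<open>g_deriv3\<close> become
  \<open>b2/8 + b3/2 = \<phi>\<^sub>3\<close> and \<open>b2/48 + b3/6 = \<phi>\<^sub>4\<close>.
\<close>
lemma DPG_local_error:
  fixes b1 b2 b3 :: "('a \<Rightarrow>\<^sub>L 'a) \<Rightarrow> ('a \<Rightarrow>\<^sub>L 'a)"
  assumes order_cond1: "\<And>v h. v \<in> strip u T r \<Longrightarrow> h > 0 \<Longrightarrow>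
          b1 (h *\<^sub>R J v) + b2 (h *\<^sub>R J v) + b3 (h *\<^sub>R J v) = phi 1 (S v) h"
    and order_cond2: "\<And>v h. v \<in> strip u T r \<Longrightarrow> h > 0 \<Longrightarrow>
          (1/4) *\<^sub>R b2 (h *\<^sub>R J v) + b3 (h *\<^sub>R J v) = 2 *\<^sub>R phi 3 (S v) h"
    and order_cond3: "\<And>v h. v \<in> strip u T r \<Longrightarrow> h > 0 \<Longrightarrow>
          (1/8) *\<^sub>R b2 (h *\<^sub>R J v) + b3 (h *\<^sub>R J v) = 6 *\<^sub>R phi 4 (S v) h"
  shows "\<exists>K. \<exists>h0>0. \<forall>t h. 0 \<le> t \<longrightarrow> 0 < h \<longrightarrow> t + h \<le> T \<longrightarrow> h \<le> h0 \<longrightarrow>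
       norm (DPG_step F J S b1 b2 b3 h (u t) - u (t + h)) \<le> K * h ^ 5"
proof -
  define \<beta>2 where "\<beta>2 = (\<lambda>t h. 16 *\<^sub>R phi 3 (S (u t)) h - 48 *\<^sub>R phi 4 (S (u t)) h)"
  define \<beta>3 where "\<beta>3 = (\<lambda>t h. 12 *\<^sub>R phi 4 (S (u t)) h - 2 *\<^sub>R phi 3 (S (u t)) h)"
  define G where "G = (\<lambda>t. nonlin F J (u t) (u t))"
  define R2 where "R2 = (\<lambda>t h. nonlin F J (u t) (stage2 F J S h (u t)) + correction F J S h (u t)
     - G t - (h\<^sup>2/8) *\<^sub>R g_deriv2 t - (h ^ 3/48) *\<^sub>R g_deriv3 t)"
  define R3 where "R3 = (\<lambda>t h. nonlin F J (u t) (stage3 F J S h (u t))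
     - G t - (h\<^sup>2/2) *\<^sub>R g_deriv2 t - (h ^ 3/6) *\<^sub>R g_deriv3 t)"
  define R where "R = (\<lambda>t h. u (t + h) - (S (u t) h (u t) + h *\<^sub>R phi 1 (S (u t)) h (G t)
     + h ^ 3 *\<^sub>R phi 3 (S (u t)) h (g_deriv2 t) + h ^ 4 *\<^sub>R phi 4 (S (u t)) h (g_deriv3 t)))"
  have O: "unif_O T 4 R2" "unif_O T 4 R3" "unif_O T 5 R"
    using g_stage2_corrected_expansion g_stage3_expansion exact_solution_expansion
    by (simp_all add: R2_def R3_def R_def G_def)
  have \<beta>: "unif_O T 0 \<beta>2" "unif_O T 0 \<beta>3"
    unfolding \<beta>2_def \<beta>3_def by (auto intro!: unif_O_diff unif_O_scaleR O_phi)
  have 2: "unif_O T 5 (\<lambda>t h. (1 * h ^ 1) *\<^sub>R \<beta>2 t h (R2 t h))"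
    by (rule unif_O_scaleR_power[OF unif_O_apply[OF \<beta>(1) O(1) order_refl]]) simp
  have 3: "unif_O T 5 (\<lambda>t h. (1 * h ^ 1) *\<^sub>R \<beta>3 t h (R3 t h))"
    by (rule unif_O_scaleR_power[OF unif_O_apply[OF \<beta>(2) O(2) order_refl]]) simp
  obtain K h0 where K: "0 \<le> K" "0 < h0" "h0 \<le> 1"
    "\<And>t h. \<lbrakk>0 \<le> t; 0 \<le> h; t + h \<le> T; h \<le> h0\<rbrakk> \<Longrightarrow>
      norm ((1 * h ^ 1) *\<^sub>R \<beta>2 t h (R2 t h) + (1 * h ^ 1) *\<^sub>R \<beta>3 t h (R3 t h) - R t h) \<le> K * h ^ 5"
    using that by (rule unif_OE[OF unif_O_diff[OF unif_O_add[OF 2 3] O(3)]])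
  show ?thesis
  proof (rule exI[of _ K], rule exI[of _ h0], intro conjI allI impI K(2))
    fix t h :: real assume th: "0 \<le> t" "0 < h" "t + h \<le> T" "h \<le> h0"
    have v: "u t \<in> strip u T r" using th by (intro u_in_strip) auto
    define p1 p3 p4 where "p1 = phi 1 (S (u t)) h" and "p3 = phi 3 (S (u t)) h"
      and "p4 = phi 4 (S (u t)) h"
    define B1 B2 B3 where "B1 = b1 (h *\<^sub>R J (u t))" and "B2 = b2 (h *\<^sub>R J (u t))"
      and "B3 = b3 (h *\<^sub>R J (u t))"
    note cond = order_cond1[OF v th(2), folded p1_def B1_def B2_def B3_def]
      order_cond2[OF v th(2), folded p3_def B2_def B3_def]
      order_cond3[OF v th(2), folded p4_def B2_def B3_def]
    have "B2 = 8 *\<^sub>R (((1/4) *\<^sub>R B2 + B3) - ((1/8) *\<^sub>R B2 + B3))"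
      by (simp add: scaleR_diff_right flip: scaleR_diff_left)
    then have B2: "B2 = 16 *\<^sub>R p3 - 48 *\<^sub>R p4"
      unfolding cond by (simp add: scaleR_diff_right)
    have "B3 = 2 *\<^sub>R ((1/8) *\<^sub>R B2 + B3) - ((1/4) *\<^sub>R B2 + B3)"
      by (simp add: scaleR_add_right scaleR_2)
    then have B3: "B3 = 12 *\<^sub>R p4 - 2 *\<^sub>R p3"
      unfolding cond by simp
    have B1: "B1 = p1 - B2 - B3"
      using cond(1) by (simp add: algebra_simps)
    have st: "nonlin F J (u t) (stage2 F J S h (u t)) + correction F J S h (u t)
        = G t + (h\<^sup>2/8) *\<^sub>R g_deriv2 t + (h ^ 3/48) *\<^sub>R g_deriv3 t + R2 t h"
      "nonlin F J (u t) (stage3 F J S h (u t)) = G t + (h\<^sup>2/2) *\<^sub>R g_deriv2 t + (h ^ 3/6) *\<^sub>R g_deriv3 t + R3 t h"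
      by (simp_all add: R2_def R3_def)
    have R: "u (t + h) = S (u t) h (u t) + h *\<^sub>R p1 (G t) + h ^ 3 *\<^sub>R p3 (g_deriv2 t) + h ^ 4 *\<^sub>R p4 (g_deriv3 t) + R t h"
      by (simp add: R_def p1_def p3_def p4_def)
    have "DPG_step F J S b1 b2 b3 h (u t) = S (u t) h (u t) + h *\<^sub>R B1 (G t)
        + h *\<^sub>R B2 (G t + (h\<^sup>2/8) *\<^sub>R g_deriv2 t + (h ^ 3/48) *\<^sub>R g_deriv3 t + R2 t h)
        + h *\<^sub>R B3 (G t + (h\<^sup>2/2) *\<^sub>R g_deriv2 t + (h ^ 3/6) *\<^sub>R g_deriv3 t + R3 t h)"
      by (simp add: DPG_step_def st B1_def B2_def B3_def G_def)
    also have "\<dots> - u (t + h) = (1 * h ^ 1) *\<^sub>R B2 (R2 t h) + (1 * h ^ 1) *\<^sub>R B3 (R3 t h) - R t h"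
      unfolding R B1 unfolding B2 B3
      by (simp add: blinfun.bilinear_simps algebra_simps eval_nat_numeral)
        (simp only: mult_2_right distrib_left scaleR_add_left add_ac)
    also have "B2 = \<beta>2 t h" by (simp add: B2 \<beta>2_def p3_def p4_def)
    also have "B3 = \<beta>3 t h" by (simp add: B3 \<beta>3_def p3_def p4_def)
    finally show "norm (DPG_step F J S b1 b2 b3 h (u t) - u (t + h)) \<le> K * h ^ 5"
      using K(4)[of t h] th by simp
  qed
qed

end

theorem theorem2:
  fixes F :: "'a::banach \<Rightarrow> 'a"
    and u :: "real \<Rightarrow> 'a" and u0 :: 'a
    and T r M C \<omega> :: real
    and J :: "'a \<Rightarrow> ('a \<Rightarrow>\<^sub>L 'a)"
    and D2 :: "'a \<Rightarrow> ('a \<Rightarrow>\<^sub>L 'a \<Rightarrow>\<^sub>L 'a)"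
    and D3 :: "'a \<Rightarrow> ('a \<Rightarrow>\<^sub>L 'a \<Rightarrow>\<^sub>L 'a \<Rightarrow>\<^sub>L 'a)"
    and D4 :: "'a \<Rightarrow> ('a \<Rightarrow>\<^sub>L 'a \<Rightarrow>\<^sub>L 'a \<Rightarrow>\<^sub>L 'a \<Rightarrow>\<^sub>L 'a)"
    and S :: "'a \<Rightarrow> real \<Rightarrow> ('a \<Rightarrow>\<^sub>L 'a)"
    and b1 b2 b3 :: "('a \<Rightarrow>\<^sub>L 'a) \<Rightarrow> ('a \<Rightarrow>\<^sub>L 'a)"
  assumes T_pos: "T > 0"
    and u_init: "u 0 = u0"
    and u_cont: "continuous_on {0..<T} u"
    and u_at_T: "(u \<longlongrightarrow> u T) (at_left T)"
    and u_ode: "\<And>t. t \<in> {0<..<T} \<Longrightarrow> (u has_vector_derivative F (u t)) (at t)"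
    and u_C1: "continuous_on {0<..<T} (\<lambda>t. vector_derivative u (at t))"
    and r_pos: "r > 0"
    and F_deriv1: "\<And>v. v \<in> strip u T r \<Longrightarrow> (F has_derivative blinfun_apply (J v)) (at v)"
    and F_deriv2: "\<And>v. v \<in> strip u T r \<Longrightarrow> (J has_derivative blinfun_apply (D2 v)) (at v)"
    and F_deriv3: "\<And>v. v \<in> strip u T r \<Longrightarrow> (D2 has_derivative blinfun_apply (D3 v)) (at v)"
    and F_deriv4: "\<And>v. v \<in> strip u T r \<Longrightarrow> (D3 has_derivative blinfun_apply (D4 v)) (at v)"
    and F_bounds: "\<And>v. v \<in> strip u T r \<Longrightarrow>
          norm (J v) \<le> M \<and> norm (D2 v) \<le> M \<and> norm (D3 v) \<le> M \<and> norm (D4 v) \<le> M"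
    and semigroup: "\<And>v. v \<in> strip u T r \<Longrightarrow> generates (J v) (S v)"
    and semigroup_bound: "\<And>v t. v \<in> strip u T r \<Longrightarrow> t \<ge> 0 \<Longrightarrow> norm (S v t) \<le> C * exp (\<omega> * t)"
    and order_cond1: "\<And>v h. v \<in> strip u T r \<Longrightarrow> h > 0 \<Longrightarrow>
          b1 (h *\<^sub>R J v) + b2 (h *\<^sub>R J v) + b3 (h *\<^sub>R J v) = phi 1 (S v) h"
    and order_cond2: "\<And>v h. v \<in> strip u T r \<Longrightarrow> h > 0 \<Longrightarrow>
          (1/4) *\<^sub>R b2 (h *\<^sub>R J v) + b3 (h *\<^sub>R J v) = 2 *\<^sub>R phi 3 (S v) h"
    and order_cond3: "\<And>v h. v \<in> strip u T r \<Longrightarrow> h > 0 \<Longrightarrow>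
          (1/8) *\<^sub>R b2 (h *\<^sub>R J v) + b3 (h *\<^sub>R J v) = 6 *\<^sub>R phi 4 (S v) h"
  shows "\<exists>K h0. h0 > 0 \<and>
           (\<forall>N::nat. \<forall>h::real. N > 0 \<and> h = T / real N \<and> h < h0 \<longrightarrow>
              (\<forall>n<N. norm (local_error F J S b1 b2 b3 u h n) \<le> K * h ^ 5))"
proof -
  have cont: "continuous_on {0..T} u"
    unfolding continuous_on_def
  proof
    fix t assume t: "t \<in> {0..T}"
    show "(u \<longlongrightarrow> u t) (at t within {0..T})"
    proof (cases "t = T")
      case True
      then show ?thesis using u_at_T T_pos by (simp add: at_within_Icc_at_left)
    next
      case False
      then have "(u \<longlongrightarrow> u t) (at t within {0..<T})"
        using u_cont t by (auto simp: continuous_on_def)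
      moreover have "at t within {0..T} = at t within {0..<T}"
        using False t by (intro at_within_nhd[of t "{..<T}"]) auto
      ultimately show ?thesis by simp
    qed
  qed
  \<comment> \<open>The absolute values make the bound monotone in time whatever the sign of \<open>\<omega>\<close>.\<close>
  interpret dpg_flow F u T r M J D2 D3 D4 S "\<bar>C\<bar> * exp (\<bar>\<omega>\<bar> * T)"
  proof unfold_locales
    fix v h assume v: "v \<in> strip u T r" and h: "0 \<le> h" "h \<le> T"
    have "\<omega> * h \<le> \<bar>\<omega>\<bar> * T"
      using h by (intro mult_mono) auto
    then have "C * exp (\<omega> * h) \<le> \<bar>C\<bar> * exp (\<bar>\<omega>\<bar> * T)"
      by (intro mult_mono) auto
    with semigroup_bound[OF v h(1)] show "norm (S v h) \<le> \<bar>C\<bar> * exp (\<bar>\<omega>\<bar> * T)" by linarith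
  qed (use assms cont in blast)+
  have "\<exists>K. \<exists>h0>0. \<forall>t h. 0 \<le> t \<longrightarrow> 0 < h \<longrightarrow> t + h \<le> T \<longrightarrow> h \<le> h0 \<longrightarrow>
       norm (DPG_step F J S b1 b2 b3 h (u t) - u (t + h)) \<le> K * h ^ 5"
    by (rule DPG_local_error) (fact order_cond1 order_cond2 order_cond3)+
  then obtain K h0 where K: "h0 > 0"
    "\<And>t h. \<lbrakk>0 \<le> t; 0 < h; t + h \<le> T; h \<le> h0\<rbrakk> \<Longrightarrow>
       norm (DPG_step F J S b1 b2 b3 h (u t) - u (t + h)) \<le> K * h ^ 5"
    by blast
  show ?thesis
  proof (rule exI[of _ K], rule exI[of _ h0], intro conjI allI impI K(1))
    fix N n :: nat and h :: real
    assume h: "0 < N \<and> h = T / real N \<and> h < h0" and n: "n < N"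
    have "h > 0" using h T_pos by simp
    have "real (Suc n) * h \<le> real N * h"
      using n \<open>h > 0\<close> by (intro mult_right_mono) auto
    moreover have "real N * h = T" using h by simp
    ultimately have "real n * h + h \<le> T" by (simp add: algebra_simps)
    moreover have "0 \<le> real n * h" using \<open>h > 0\<close> by simp
    moreover have "h \<le> h0" using h by simp
    ultimately have "norm (DPG_step F J S b1 b2 b3 h (u (real n * h)) - u (real n * h + h)) \<le> K * h ^ 5"
      using \<open>h > 0\<close> by (intro K(2))
    then show "norm (local_error F J S b1 b2 b3 u h n) \<le> K * h ^ 5"
      by (simp add: local_error_def algebra_simps)
  qed
qed

end
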